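(* Let $0<q<1$. Let $\mathcal{H}$, the representation $\pi'$ of $\mathcal{A}(\mathrm{SU}_q(2))$, $F$ and $K$ be as in the context, and let $$V=\begin{pmatrix}-qb^* & a^* \\ a & b\end{pmatrix}\in M_2\big(\mathcal{A}(\mathrm{SU}_q(2))\big).$$ Then the modular index of $V$ relative to the odd modular Fredholm module $(\mathcal{A}(\mathrm{SU}_q(2)),\mathcal{H},F)$ is equal to $1$.
   Context: $\mathcal{A}(\mathrm{SU}_q(2))$ is the universal unital $*$-algebra generated by $a,b$ with relations $ba=qab$, $bb^*=b^*b$, $b^*a=qab^*$, $aa^*+bb^*=1$, $a^*a+q^2bb^*=1$. Notation: $[k]=(q^{-k}-q^k)/(q^{-1}-q)$; $x^\pm=x\pm\frac12$ for $x=j,\mu,n$. For $j\in\frac12\mathbb{N}=\{0,\frac12,1,\dots\}$ let $W_j^\uparrow$ have orthonormal basis $|j\mu n\uparrow\rangle$, $\mu=-j,\dots,j$, $n=-j^+,\dots,j^+$, and $W_j^\downarrow$ have orthonormal basis $|j\mu n\downarrow\rangle$, $\mu=-j,\dots,j$, $n=-j^-,\dots,j^-$ (steps of $1$; $W_0^\downarrow=0$). $\mathcal{H}$ is the completion of $\bigoplus_{2j=0}^\infty W_j^\uparrow\oplus W_j^\downarrow$. Representation $\pi'$: $\pi'(a)|j\mu n\uparrow\rangle=\alpha^+_{j\mu n\uparrow\uparrow}|j^+\mu^+n^+\uparrow\rangle+\alpha^+_{j\mu n\downarrow\uparrow}|j^+\mu^+n^+\downarrow\rangle+\alpha^-_{j\mu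 n\uparrow\uparrow}|j^-\mu^+n^+\uparrow\rangle$, $\pi'(a)|j\mu n\downarrow\rangle=\alpha^+_{j\mu n\downarrow\downarrow}|j^+\mu^+n^+\downarrow\rangle+\alpha^-_{j\mu n\downarrow\downarrow}|j^-\mu^+n^+\downarrow\rangle+\alpha^-_{j\mu n\uparrow\downarrow}|j^-\mu^+n^+\uparrow\rangle$, and $\pi'(b)$ is given by the same formulas with $\alpha$ replaced by $\beta$ and $n^+$ replaced by $n^-$. Writing coefficient matrices as $\begin{pmatrix}\uparrow\uparrow&\uparrow\downarrow\\ \downarrow\uparrow&\downarrow\downarrow\end{pmatrix}$ and $c=q^{(\mu+n-\frac12)/2}$: $$\alpha^+_{j\mu n}=c\,[j+\mu+1]^{\frac12}\begin{pmatrix}q^{-j-\frac12}\frac{[j+n+\frac32]^{1/2}}{[2j+2]}&0\\ q^{\frac12}\frac{[j-n+\frac12]^{1/2}}{[2j+1][2j+2]}&q^{-j}\frac{[j+n+\frac12]^{1/2}}{[2j+1]}\end{pmatrix},$$ $$\alpha^-_{j\mu n}=c\,[j-\mu]^{\frac12}\begin{pmatrix}q^{j+1}\frac{[j-n+\frac12]^{1/2}}{[2j+1]}&-q^{\frac12}\frac{[j+n+\frac12]^{1/2}}{[2j][2j+1]}\\0&q^{j+\frac12}\frac{[j-n-\frac12]^{1/2}}{[2j]}\end{pmatrix},$$ $$\beta^+_{j\mu n}=c\,[j+\mu+1]^{\frac12}\begin{pmatrix}\frac{[j-n+\frac32]^{1/2}}{[2j+2]}&0\\-q^{-j-1}\frac{[j+n+\frac12]^{1/2}}{[2j+1][2j+2]}&q^{-\frac12}\frac{[j-n+\frac12]^{1/2}}{[2j+1]}\end{pmatrix},$$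 $$\beta^-_{j\mu n}=c\,[j-\mu]^{\frac12}\begin{pmatrix}-q^{-\frac12}\frac{[j+n+\frac12]^{1/2}}{[2j+1]}&-q^j\frac{[j-n+\frac12]^{1/2}}{[2j][2j+1]}\\0&-\frac{[j+n-\frac12]^{1/2}}{[2j]}\end{pmatrix}.$$ (That these formulas define a $*$-representation is known.) The algebra is identified with its image. $F$ equals $+1$ on every $W_j^\uparrow$ and $-1$ on every $W_j^\downarrow$. $K$ is the unbounded positive operator with $K|j\mu n\uparrow\rangle=q^{-2(\mu+n)}|j\mu n\uparrow\rangle$ and $K|j\mu n\downarrow\rangle=q^{-2(\mu+n)}|j\mu n\downarrow\rangle$. On $\mathcal{H}\otimes\mathbb{C}^2$ put $\tilde K=K\otimes\begin{pmatrix}q^{-1}&0\\0&q\end{pmatrix}$ and $E=\frac12(1+F)\otimes1$. $V$ is a unitary commuting with $\tilde K$. The modular index of $V$ is that of $EVEV^*$ regarded as a Fredholm operator $T:VE(\mathcal{H}\otimes\mathbb{C}^2)\to E(\mathcal{H}\otimes\mathbb{C}^2)$, namely $\mathrm{Tr}(\tilde K|_{\ker T})-\mathrm{Tr}(\tilde K|_{\mathrm{coker}\,T})$, where the kernel and cokernel (the latter identified with the orthogonal complement of the range) are finite-dimensional and $\tilde K$-invariant. *)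

theory Defs
  imports "HOL-Analysis.Analysis"
begin

section \<open>Complex Hilbert spaces\<close>

text \<open>The inner product is conjugate-linear in its first argument. The underlying real
  structure, norm and topology are those of the class \<^class>\<open>real_inner\<close>.\<close>

class complex_inner = real_inner +
  fixes scaleC :: "complex \<Rightarrow> 'a \<Rightarrow> 'a" (infixr "*\<^sub>C" 75)
    and cinner :: "'a \<Rightarrow> 'a \<Rightarrow> complex"
  assumes scaleC_add_right: "c *\<^sub>C (x + y) = c *\<^sub>C x + c *\<^sub>C y"
    and scaleC_add_left: "(c + d) *\<^sub>C x = c *\<^sub>C x + d *\<^sub>C x"
    and scaleC_scaleC: "c *\<^sub>C (d *\<^sub>C x) = (c * d) *\<^sub>C x"
    and scaleC_of_real: "of_real r *\<^sub>C x = r *\<^sub>R x"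
    and cinner_commute: "cinner x y = cnj (cinner y x)"
    and cinner_add_left: "cinner (x + y) z = cinner x z + cinner y z"
    and cinner_scaleC_left: "cinner (c *\<^sub>C x) y = cnj c * cinner x y"
    and inner_eq_Re_cinner: "inner x y = Re (cinner x y)"

class chilbert_space = complex_inner + complete_space

instantiation prod :: (complex_inner, complex_inner) complex_inner
begin

definition scaleC_prod_def: "c *\<^sub>C x = (c *\<^sub>C fst x, c *\<^sub>C snd x)"

definition cinner_prod_def: "cinner x y = cinner (fst x) (fst y) + cinner (snd x) (snd y)"

instance
proof
  fix x y :: "'a \<times> 'b"
  have "cinner (fst x) (fst y) = cnj (cinner (fst y) (fst x))"
    "cinner (snd x) (snd y) = cnj (cinner (snd y) (snd x))"
    by (rule cinner_commute)+
  then show "cinner x y = cnj (cinner y x)"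
    by (simp add: cinner_prod_def)
qed (simp_all add: scaleC_prod_def cinner_prod_def scaleC_add_right scaleC_add_left
    scaleC_scaleC scaleC_of_real cinner_add_left cinner_scaleC_left inner_eq_Re_cinner
    inner_prod_def scaleR_prod_def prod_eq_iff algebra_simps)

end

instance prod :: (chilbert_space, chilbert_space) chilbert_space ..

definition cspan :: "'h::complex_inner set \<Rightarrow> 'h set" where
  "cspan B = {\<Sum>b\<in>t. c b *\<^sub>C b | t c. finite t \<and> t \<subseteq> B}"

definition finite_cdim :: "'h::complex_inner set \<Rightarrow> bool" where
  "finite_cdim S \<longleftrightarrow> (\<exists>B. finite B \<and> cspan B = S)"

definition onb_of :: "'h::complex_inner set \<Rightarrow> 'h set \<Rightarrow> bool" where
  "onb_of B S \<longleftrightarrow> finite B \<and> (\<forall>x\<in>B. \<forall>y\<in>B. cinner x y = (if x = y then 1 else 0)) \<and> cspan B = S"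

text \<open>The trace of the restriction of \<open>L\<close> to a finite-dimensional \<open>L\<close>-invariant
  subspace \<open>S\<close>; it does not depend on the chosen orthonormal basis.\<close>

definition trace_on :: "('h::complex_inner \<Rightarrow> 'h) \<Rightarrow> 'h set \<Rightarrow> complex" where
  "trace_on L S = (\<Sum>b\<in>(SOME B. onb_of B S). cinner b (L b))"

definition bounded_clinear :: "('h::complex_inner \<Rightarrow> 'k::complex_inner) \<Rightarrow> bool" where
  "bounded_clinear A \<longleftrightarrow> bounded_linear A \<and> (\<forall>c x. A (c *\<^sub>C x) = c *\<^sub>C A x)"

definition cadjoint :: "('h::complex_inner \<Rightarrow> 'k::complex_inner) \<Rightarrow> 'k \<Rightarrow> 'h" where
  "cadjoint A = (SOME B. \<forall>x y. cinner (A x) y = cinner x (B y))"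

definition unitary_op :: "('h::chilbert_space \<Rightarrow> 'h) \<Rightarrow> bool" where
  "unitary_op U \<longleftrightarrow> bounded_clinear U \<and> cadjoint U \<circ> U = id \<and> U \<circ> cadjoint U = id"

text \<open>An unbounded operator is a map \<open>K\<close> together with its domain \<open>D\<close>; the values
  of \<open>K\<close> outside \<open>D\<close> are irrelevant.\<close>

definition commutes_with_unbounded ::
  "('h::chilbert_space \<Rightarrow> 'h) \<Rightarrow> 'h set \<Rightarrow> ('h \<Rightarrow> 'h) \<Rightarrow> bool" where
  "commutes_with_unbounded U D K \<longleftrightarrow> U ` D = D \<and> (\<forall>x\<in>D. U (K x) = K (U x))"

definition op_ker :: "('h::complex_inner \<Rightarrow> 'h) \<Rightarrow> 'h set \<Rightarrow> 'h set" where
  "op_ker T X = {x\<in>X. T x = 0}"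

definition op_coker :: "('h::complex_inner \<Rightarrow> 'h) \<Rightarrow> 'h set \<Rightarrow> 'h set \<Rightarrow> 'h set" where
  "op_coker T X Y = {y\<in>Y. \<forall>x\<in>X. cinner (T x) y = 0}"

definition fredholm_between :: "('h::chilbert_space \<Rightarrow> 'h) \<Rightarrow> 'h set \<Rightarrow> 'h set \<Rightarrow> bool" where
  "fredholm_between T X Y \<longleftrightarrow> bounded_clinear T \<and> T ` X \<subseteq> Y \<and> closed (T ` X)
     \<and> finite_cdim (op_ker T X) \<and> finite_cdim (op_coker T X Y)"

text \<open>The modular index is only defined when all the side conditions hold, so it is a
  relation: \<open>V\<close> has modular index \<open>m\<close> with respect to the unbounded operator \<open>K\<close>
  with domain \<open>D\<close> and the projection \<open>E\<close>.\<close>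

definition has_modular_index ::
  "'h::chilbert_space set \<Rightarrow> ('h \<Rightarrow> 'h) \<Rightarrow> ('h \<Rightarrow> 'h) \<Rightarrow> ('h \<Rightarrow> 'h) \<Rightarrow> complex \<Rightarrow> bool" where
  "has_modular_index D K E V m \<longleftrightarrow>
     unitary_op V \<and> commutes_with_unbounded V D K \<and>
     (let T = E \<circ> V \<circ> E \<circ> cadjoint V; X = range (V \<circ> E); Y = range E;
          N = op_ker T X; C = op_coker T X Y
      in fredholm_between T X Y \<and>
         N \<subseteq> D \<and> K ` N \<subseteq> N \<and> C \<subseteq> D \<and> K ` C \<subseteq> C \<and>
         m = trace_on K N - trace_on K C)"


section \<open>Square-summable functions\<close>

typedef 'a ell2 = "{f :: 'a \<Rightarrow> complex. (\<lambda>x. (cmod (f x))\<^sup>2) summable_on UNIV}"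
  morphisms coord Abs_ell2
  by (rule exI[of _ "\<lambda>_. 0"]) simp

setup_lifting type_definition_ell2

lemma ell2_add_summable:
  fixes f g :: "'a \<Rightarrow> complex"
  assumes "(\<lambda>x. (cmod (f x))\<^sup>2) summable_on UNIV" "(\<lambda>x. (cmod (g x))\<^sup>2) summable_on UNIV"
  shows "(\<lambda>x. (cmod (f x + g x))\<^sup>2) summable_on UNIV"
proof (rule summable_on_comparison_test)
  show "(\<lambda>x. 2 * (cmod (f x))\<^sup>2 + 2 * (cmod (g x))\<^sup>2) summable_on UNIV"
    using assms by (intro summable_on_add summable_on_cmult_right)
  fix x
  have "(cmod (f x + g x))\<^sup>2 \<le> (cmod (f x) + cmod (g x))\<^sup>2"
    by (intro power_mono norm_triangle_ineq) auto
  also have "\<dots> \<le> 2 * (cmod (f x))\<^sup>2 + 2 * (cmod (g x))\<^sup>2"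
    using zero_le_power2[of "cmod (f x) - cmod (g x)"]
    by (simp add: power2_eq_square algebra_simps)
  finally show "(cmod (f x + g x))\<^sup>2 \<le> 2 * (cmod (f x))\<^sup>2 + 2 * (cmod (g x))\<^sup>2" .
qed auto

lemma ell2_scale_summable:
  fixes f :: "'a \<Rightarrow> complex"
  assumes "(\<lambda>x. (cmod (f x))\<^sup>2) summable_on UNIV"
  shows "(\<lambda>x. (cmod (c * f x))\<^sup>2) summable_on UNIV"
  using summable_on_cmult_right[OF assms, of "(cmod c)\<^sup>2"]
  by (simp add: norm_mult power_mult_distrib)

lemma ell2_mult_summable:
  fixes f g :: "'a \<Rightarrow> complex"
  assumes "(\<lambda>x. (cmod (f x))\<^sup>2) summable_on UNIV" "(\<lambda>x. (cmod (g x))\<^sup>2) summable_on UNIV"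
  shows "(\<lambda>x. cnj (f x) * g x) summable_on UNIV"
proof (rule abs_summable_summable, rule summable_on_comparison_test)
  show "(\<lambda>x. (cmod (f x))\<^sup>2 + (cmod (g x))\<^sup>2) summable_on UNIV"
    using assms by (rule summable_on_add)
  fix x
  have "2 * (cmod (f x) * cmod (g x)) \<le> (cmod (f x))\<^sup>2 + (cmod (g x))\<^sup>2"
    using sum_squares_bound[of "cmod (f x)" "cmod (g x)"] by simp
  moreover have "0 \<le> cmod (f x) * cmod (g x)" by simp
  ultimately have "cmod (f x) * cmod (g x) \<le> (cmod (f x))\<^sup>2 + (cmod (g x))\<^sup>2" by linarith
  then show "norm (cnj (f x) * g x) \<le> (cmod (f x))\<^sup>2 + (cmod (g x))\<^sup>2"
    by (simp add: norm_mult)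
qed auto

lemma coord_summable: "(\<lambda>x. (cmod (coord f x))\<^sup>2) summable_on UNIV"
  using coord[of f] by simp

lemma coord_mult_summable: "(\<lambda>x. cnj (coord f x) * coord g x) summable_on UNIV"
  by (intro ell2_mult_summable coord_summable)

lemma infsum_complex_of_real:
  fixes f :: "'a \<Rightarrow> real"
  assumes "f summable_on A"
  shows "(\<Sum>\<^sub>\<infinity>x\<in>A. complex_of_real (f x)) = of_real (\<Sum>\<^sub>\<infinity>x\<in>A. f x)"
  using assms by (intro infsumI) (simp add: has_sum_of_real_iff)

lemma ell2_eqI: "(\<And>x. coord f x = coord g x) \<Longrightarrow> f = g"
  by (metis coord_inject ext)

instantiation ell2 :: (type) real_vector
begin

lift_definition zero_ell2 :: "'a ell2" is "\<lambda>_. 0" by simp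

lift_definition plus_ell2 :: "'a ell2 \<Rightarrow> 'a ell2 \<Rightarrow> 'a ell2" is "\<lambda>f g x. f x + g x"
  by (rule ell2_add_summable)

lift_definition uminus_ell2 :: "'a ell2 \<Rightarrow> 'a ell2" is "\<lambda>f x. - f x"
  by simp

lift_definition minus_ell2 :: "'a ell2 \<Rightarrow> 'a ell2 \<Rightarrow> 'a ell2" is "\<lambda>f g x. f x - g x"
  using ell2_add_summable[of _ "\<lambda>x. - (_ x)"] by simp

lift_definition scaleR_ell2 :: "real \<Rightarrow> 'a ell2 \<Rightarrow> 'a ell2" is "\<lambda>r f x. of_real r * f x"
  by (rule ell2_scale_summable)

instance
proof
  fix f g h :: "'a ell2" and r s :: real
  show "f + g + h = f + (g + h)" by transfer (simp add: algebra_simps)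
  show "f + g = g + f" by transfer (simp add: algebra_simps)
  show "0 + f = f" by transfer simp
  show "- f + f = 0" by transfer simp
  show "f - g = f + - g" by transfer simp
  show "r *\<^sub>R (f + g) = r *\<^sub>R f + r *\<^sub>R g" by transfer (simp add: algebra_simps)
  show "(r + s) *\<^sub>R f = r *\<^sub>R f + s *\<^sub>R f" by transfer (simp add: algebra_simps)
  show "r *\<^sub>R s *\<^sub>R f = (r * s) *\<^sub>R f" by transfer (simp add: algebra_simps)
  show "1 *\<^sub>R f = f" by transfer simp
qed

end

instantiation ell2 :: (type) complex_inner
begin

lift_definition scaleC_ell2 :: "complex \<Rightarrow> 'a ell2 \<Rightarrow> 'a ell2" is "\<lambda>c f x. c * f x"
  by (rule ell2_scale_summable)

definition cinner_ell2_def: "cinner f g = (\<Sum>\<^sub>\<infinity>x. cnj (coord f x) * coord g x)"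

definition inner_ell2_def: "inner f g = Re (cinner f g)" for f g :: "'a ell2"
definition norm_ell2_def: "norm f = sqrt (inner f f)" for f :: "'a ell2"
definition dist_ell2_def: "dist f g = norm (f - g)" for f g :: "'a ell2"
definition sgn_ell2_def: "sgn f = f /\<^sub>R norm f" for f :: "'a ell2"
definition uniformity_ell2_def [code del]:
  "(uniformity :: ('a ell2 \<times> 'a ell2) filter) = (INF e\<in>{0<..}. principal {(f, g). dist f g < e})"
definition open_ell2_def [code del]:
  "open (S :: 'a ell2 set) \<longleftrightarrow> (\<forall>f\<in>S. \<forall>\<^sub>F (f', g) in uniformity. f' = f \<longrightarrow> g \<in> S)"

instance
proof
  fix f g h :: "'a ell2" and r :: real and c d :: complex and S :: "'a ell2 set"
  show "c *\<^sub>C (f + g) = c *\<^sub>C f + c *\<^sub>C g" by transfer (simp add: algebra_simps)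
  show "(c + d) *\<^sub>C f = c *\<^sub>C f + d *\<^sub>C f" by transfer (simp add: algebra_simps)
  show "c *\<^sub>C (d *\<^sub>C f) = (c * d) *\<^sub>C f" by transfer (simp add: algebra_simps)
  show "of_real r *\<^sub>C f = r *\<^sub>R f" by transfer simp
  show "dist f g = norm (f - g)" by (rule dist_ell2_def)
  show "sgn f = f /\<^sub>R norm f" by (rule sgn_ell2_def)
  show "(uniformity :: ('a ell2 \<times> 'a ell2) filter) = (INF e\<in>{0<..}. principal {(f, g). dist f g < e})"
    by (rule uniformity_ell2_def)
  show "open S \<longleftrightarrow> (\<forall>f\<in>S. \<forall>\<^sub>F (f', g) in uniformity. f' = f \<longrightarrow> g \<in> S)"
    by (rule open_ell2_def)
  show "inner f g = Re (cinner f g)" by (rule inner_ell2_def)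
  show "norm f = sqrt (inner f f)" by (rule norm_ell2_def)
  show comm: "cinner f g = cnj (cinner g f)" for f g :: "'a ell2"
    by (simp add: cinner_ell2_def mult.commute flip: infsum_cnj)
  show add: "cinner (f + g) h = cinner f h + cinner g h"
    using infsum_add[OF coord_mult_summable[of f h] coord_mult_summable[of g h]]
    by (simp add: cinner_ell2_def plus_ell2.rep_eq distrib_right)
  show sc: "cinner (c *\<^sub>C f) g = cnj c * cinner f g" for c
    by (simp add: cinner_ell2_def scaleC_ell2.rep_eq mult.assoc infsum_cmult_right')
  have R: "r *\<^sub>R f = of_real r *\<^sub>C f" by transfer simp
  show "inner f g = inner g f"
    using comm[of f g] by (simp add: inner_ell2_def)
  show "inner (f + g) h = inner f h + inner g h"
    by (simp add: inner_ell2_def add)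
  show "inner (r *\<^sub>R f) g = r * inner f g"
    by (simp add: inner_ell2_def R sc)
  have sq: "inner f f = (\<Sum>\<^sub>\<infinity>x. (cmod (coord f x))\<^sup>2)"
  proof -
    have "cinner f f = (\<Sum>\<^sub>\<infinity>x. of_real ((cmod (coord f x))\<^sup>2))"
      by (simp only: cinner_ell2_def complex_norm_square mult.commute)
    also have "\<dots> = of_real (\<Sum>\<^sub>\<infinity>x. (cmod (coord f x))\<^sup>2)"
      by (intro infsum_complex_of_real coord_summable)
    finally show ?thesis by (simp add: inner_ell2_def)
  qed
  show "0 \<le> inner f f"
    unfolding sq by (rule infsum_nonneg) simp
  show "inner f f = 0 \<longleftrightarrow> f = 0"
  proof
    assume "inner f f = 0"
    then have "(\<Sum>\<^sub>\<infinity>x. (cmod (coord f x))\<^sup>2) = 0" by (simp add: sq)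
    then have "(cmod (coord f x))\<^sup>2 = 0" for x
      by (intro nonneg_infsum_le_0D[OF _ coord_summable[of f]]) auto
    then show "f = 0"
      by (intro ell2_eqI) (simp add: zero_ell2.rep_eq)
  next
    assume "f = 0"
    then show "inner f f = 0" by (subst sq) (simp add: zero_ell2.rep_eq)
  qed
qed

end

lemma norm_ell2_sq: "(norm f)\<^sup>2 = (\<Sum>\<^sub>\<infinity>x. (cmod (coord f x))\<^sup>2)" for f :: "'a ell2"
proof -
  have "cinner f f = (\<Sum>\<^sub>\<infinity>x. of_real ((cmod (coord f x))\<^sup>2))"
    by (simp only: cinner_ell2_def complex_norm_square mult.commute)
  also have "\<dots> = of_real (\<Sum>\<^sub>\<infinity>x. (cmod (coord f x))\<^sup>2)"
    by (intro infsum_complex_of_real coord_summable)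
  finally show ?thesis
    by (simp add: power2_norm_eq_inner inner_ell2_def)
qed

lemma finite_sum_le_norm_ell2:
  fixes f :: "'a ell2"
  assumes "finite A"
  shows "(\<Sum>x\<in>A. (cmod (coord f x))\<^sup>2) \<le> (norm f)\<^sup>2"
  unfolding norm_ell2_sq using assms by (intro finite_sum_le_infsum coord_summable) auto

lemma cmod_coord_le_norm: "cmod (coord f x) \<le> norm f"
  by (rule power2_le_imp_le) (use finite_sum_le_norm_ell2[of "{x}" f] in auto)

instance ell2 :: (type) complete_space
proof
  fix X :: "nat \<Rightarrow> 'a ell2"
  assume C: "Cauchy X"
  have "Cauchy (\<lambda>n. coord (X n) i)" for i
  proof (rule metric_CauchyI)
    fix e :: real assume "e > 0"
    then obtain N where N: "\<And>m n. m \<ge> N \<Longrightarrow> n \<ge> N \<Longrightarrow> dist (X m) (X n) < e"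
      using metric_CauchyD[OF C \<open>e > 0\<close>] by auto
    have "dist (coord (X m) i) (coord (X n) i) < e" if "m \<ge> N" "n \<ge> N" for m n
      using cmod_coord_le_norm[of "X m - X n" i] N[OF that]
      by (simp add: dist_norm minus_ell2.rep_eq)
    then show "\<exists>M. \<forall>m\<ge>M. \<forall>n\<ge>M. dist (coord (X m) i) (coord (X n) i) < e" by blast
  qed
  then have "\<exists>l. (\<lambda>n. coord (X n) i) \<longlonglongrightarrow> l" for i
    by (simp add: Cauchy_convergent_iff convergent_def)
  then obtain L where L: "\<And>i. (\<lambda>n. coord (X n) i) \<longlonglongrightarrow> L i" by metis
  have fin: "(\<Sum>i\<in>A. (cmod (L i - coord (X n) i))\<^sup>2) \<le> e\<^sup>2"
    if "finite A" "\<And>m. m \<ge> N \<Longrightarrow> dist (X m) (X n) < e" for e A n N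
  proof (rule LIMSEQ_le_const2)
    show "(\<lambda>m. \<Sum>i\<in>A. (cmod (coord (X m) i - coord (X n) i))\<^sup>2)
        \<longlonglongrightarrow> (\<Sum>i\<in>A. (cmod (L i - coord (X n) i))\<^sup>2)"
      by (intro tendsto_intros L)
    have "(\<Sum>i\<in>A. (cmod (coord (X m) i - coord (X n) i))\<^sup>2) \<le> e\<^sup>2" if "m \<ge> N" for m
    proof -
      have "(\<Sum>i\<in>A. (cmod (coord (X m) i - coord (X n) i))\<^sup>2) \<le> (norm (X m - X n))\<^sup>2"
        using finite_sum_le_norm_ell2[OF \<open>finite A\<close>, of "X m - X n"] by (simp add: minus_ell2.rep_eq)
      also have "\<dots> \<le> e\<^sup>2"
        using \<open>\<And>m. m \<ge> N \<Longrightarrow> dist (X m) (X n) < e\<close>[OF that]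
        by (intro power_mono) (auto simp: dist_norm)
      finally show ?thesis .
    qed
    then show "\<exists>M. \<forall>m\<ge>M. (\<Sum>i\<in>A. (cmod (coord (X m) i - coord (X n) i))\<^sup>2) \<le> e\<^sup>2" by blast
  qed
  have Y: "(\<lambda>i. (cmod (L i - coord (X n) i))\<^sup>2) summable_on UNIV"
    if "\<And>m. m \<ge> N \<Longrightarrow> dist (X m) (X n) < e" for n N e
  proof (rule nonneg_bdd_above_summable_on)
    have "(\<Sum>i\<in>A. (cmod (L i - coord (X n) i))\<^sup>2) \<le> e\<^sup>2" if "finite A" for A
      by (rule fin[of A N n e]) (use that \<open>\<And>m. m \<ge> N \<Longrightarrow> dist (X m) (X n) < e\<close> in auto)
    then show "bdd_above (sum (\<lambda>i. (cmod (L i - coord (X n) i))\<^sup>2) ` {A. A \<subseteq> UNIV \<and> finite A})"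
      by (intro bdd_aboveI2[where M = "e\<^sup>2"]) auto
  qed simp
  obtain N1 where N1: "\<And>m n. m \<ge> N1 \<Longrightarrow> n \<ge> N1 \<Longrightarrow> dist (X m) (X n) < 1"
    using metric_CauchyD[OF C, of 1] by auto
  have "(\<lambda>i. (cmod ((L i - coord (X N1) i) + coord (X N1) i))\<^sup>2) summable_on UNIV"
    by (rule ell2_add_summable[OF Y[of N1 N1 1] coord_summable]) (simp add: N1)
  then have mem: "(\<lambda>i. (cmod (L i))\<^sup>2) summable_on UNIV" by simp
  define l where "l = Abs_ell2 L"
  have cl: "coord l = L" unfolding l_def using mem by (simp add: Abs_ell2_inverse)
  have "X \<longlonglongrightarrow> l"
  proof (rule metric_LIMSEQ_I)
    fix r :: real assume "r > 0"
    define e where "e = r / 2"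
    have "e > 0" "e < r" using \<open>r > 0\<close> by (auto simp: e_def)
    then obtain N where N: "\<And>m n. m \<ge> N \<Longrightarrow> n \<ge> N \<Longrightarrow> dist (X m) (X n) < e"
      using metric_CauchyD[OF C \<open>e > 0\<close>] by auto
    have "dist (X n) l < r" if "n \<ge> N" for n
    proof -
      have Nn: "\<And>m. m \<ge> N \<Longrightarrow> dist (X m) (X n) < e" using N that by blast
      have "(norm (l - X n))\<^sup>2 = (\<Sum>\<^sub>\<infinity>i. (cmod (L i - coord (X n) i))\<^sup>2)"
        by (simp add: norm_ell2_sq minus_ell2.rep_eq cl)
      also have "\<dots> \<le> e\<^sup>2"
      proof (rule infsum_le_finite_sums)
        show "(\<lambda>i. (cmod (L i - coord (X n) i))\<^sup>2) summable_on UNIV"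
          by (rule Y[of N n e]) (rule Nn)
        show "(\<Sum>i\<in>A. (cmod (L i - coord (X n) i))\<^sup>2) \<le> e\<^sup>2" if "finite A" for A
          by (rule fin[of A N n e]) (use that Nn in auto)
      qed
      finally have "norm (l - X n) \<le> e"
        by (rule power2_le_imp_le) (use \<open>e > 0\<close> in simp)
      then show ?thesis using \<open>e < r\<close> by (simp add: dist_norm norm_minus_commute)
    qed
    then show "\<exists>no. \<forall>n\<ge>no. dist (X n) l < r" by blast
  qed
  then show "convergent X" by (rule convergentI)
qed

instance ell2 :: (type) chilbert_space ..

definition ell2_unit :: "'a \<Rightarrow> 'a ell2" where
  "ell2_unit x = Abs_ell2 (\<lambda>y. if y = x then 1 else 0)"

text \<open>The possibly unbounded diagonal operator with entries \<open>d\<close>, on its maximal domain.\<close>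

definition diag_dom :: "('a \<Rightarrow> real) \<Rightarrow> 'a ell2 set" where
  "diag_dom d = {\<psi>. (\<lambda>x. (cmod (of_real (d x) * coord \<psi> x))\<^sup>2) summable_on UNIV}"

definition diag_op :: "('a \<Rightarrow> real) \<Rightarrow> 'a ell2 \<Rightarrow> 'a ell2" where
  "diag_op d \<psi> = Abs_ell2 (\<lambda>x. of_real (d x) * coord \<psi> x)"


section \<open>The coordinate algebra of quantum SU(2)\<close>

text \<open>The universal unital *-algebra on two generators subject to the defining relations:
  *-algebra expressions modulo the least congruence containing the axioms of a
  unital complex *-algebra and the relations.\<close>

datatype suq2_expr =
    GenA | GenB | Zero | One
  | Add suq2_expr suq2_expr
  | Mul suq2_expr suq2_expr
  | Scale complex suq2_expr
  | Star suq2_expr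

inductive suq2_eq :: "real \<Rightarrow> suq2_expr \<Rightarrow> suq2_expr \<Rightarrow> bool" for q :: real where
  eq_refl: "suq2_eq q x x"
| eq_sym: "suq2_eq q x y \<Longrightarrow> suq2_eq q y x"
| eq_trans: "suq2_eq q x y \<Longrightarrow> suq2_eq q y z \<Longrightarrow> suq2_eq q x z"
| cong_add: "suq2_eq q x x' \<Longrightarrow> suq2_eq q y y' \<Longrightarrow> suq2_eq q (Add x y) (Add x' y')"
| cong_mul: "suq2_eq q x x' \<Longrightarrow> suq2_eq q y y' \<Longrightarrow> suq2_eq q (Mul x y) (Mul x' y')"
| cong_scale: "suq2_eq q x x' \<Longrightarrow> suq2_eq q (Scale c x) (Scale c x')"
| cong_star: "suq2_eq q x x' \<Longrightarrow> suq2_eq q (Star x) (Star x')"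
| add_assoc: "suq2_eq q (Add (Add x y) z) (Add x (Add y z))"
| add_comm: "suq2_eq q (Add x y) (Add y x)"
| add_zero: "suq2_eq q (Add x Zero) x"
| add_neg: "suq2_eq q (Add x (Scale (-1) x)) Zero"
| scale_add: "suq2_eq q (Scale c (Add x y)) (Add (Scale c x) (Scale c y))"
| add_scale: "suq2_eq q (Scale (c + d) x) (Add (Scale c x) (Scale d x))"
| scale_scale: "suq2_eq q (Scale c (Scale d x)) (Scale (c * d) x)"
| scale_one: "suq2_eq q (Scale 1 x) x"
| mul_assoc: "suq2_eq q (Mul (Mul x y) z) (Mul x (Mul y z))"
| mul_one_left: "suq2_eq q (Mul One x) x"
| mul_one_right: "suq2_eq q (Mul x One) x"
| distrib_left: "suq2_eq q (Mul x (Add y z)) (Add (Mul x y) (Mul x z))"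
| distrib_right: "suq2_eq q (Mul (Add x y) z) (Add (Mul x z) (Mul y z))"
| scale_mul_left: "suq2_eq q (Mul (Scale c x) y) (Scale c (Mul x y))"
| scale_mul_right: "suq2_eq q (Mul x (Scale c y)) (Scale c (Mul x y))"
| star_add: "suq2_eq q (Star (Add x y)) (Add (Star x) (Star y))"
| star_scale: "suq2_eq q (Star (Scale c x)) (Scale (cnj c) (Star x))"
| star_mul: "suq2_eq q (Star (Mul x y)) (Mul (Star y) (Star x))"
| star_star: "suq2_eq q (Star (Star x)) x"
| rel_ba: "suq2_eq q (Mul GenB GenA) (Scale (of_real q) (Mul GenA GenB))"
| rel_normal: "suq2_eq q (Mul GenB (Star GenB)) (Mul (Star GenB) GenB)"
| rel_bstar_a: "suq2_eq q (Mul (Star GenB) GenA) (Scale (of_real q) (Mul GenA (Star GenB)))"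
| rel_sphere1: "suq2_eq q (Add (Mul GenA (Star GenA)) (Mul GenB (Star GenB))) One"
| rel_sphere2: "suq2_eq q (Add (Mul (Star GenA) GenA)
      (Scale (of_real (q\<^sup>2)) (Mul GenB (Star GenB)))) One"

text \<open>The algebra is the set of all classes \<open>suq2_class q x\<close>, with the operations induced
  by those on expressions.\<close>

type_synonym suq2_elem = "suq2_expr set"

definition suq2_class :: "real \<Rightarrow> suq2_expr \<Rightarrow> suq2_elem" where
  "suq2_class q x = {y. suq2_eq q x y}"

definition suq2_star_rep :: "real \<Rightarrow> (suq2_elem \<Rightarrow> 'h::chilbert_space \<Rightarrow> 'h) \<Rightarrow> bool" where
  "suq2_star_rep q \<rho> \<longleftrightarrow>
     (\<forall>x. bounded_clinear (\<rho> (suq2_class q x)))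
   \<and> \<rho> (suq2_class q One) = id
   \<and> (\<forall>x y. \<rho> (suq2_class q (Add x y)) = (\<lambda>v. \<rho> (suq2_class q x) v + \<rho> (suq2_class q y) v))
   \<and> (\<forall>x y. \<rho> (suq2_class q (Mul x y)) = \<rho> (suq2_class q x) \<circ> \<rho> (suq2_class q y))
   \<and> (\<forall>c x. \<rho> (suq2_class q (Scale c x)) = (\<lambda>v. c *\<^sub>C \<rho> (suq2_class q x) v))
   \<and> (\<forall>x v w. cinner (\<rho> (suq2_class q x) v) w = cinner v (\<rho> (suq2_class q (Star x)) w))"


section \<open>The Hilbert space and the representation\<close>

datatype arrow = Up | Down

text \<open>The quantum numbers \<open>j\<close>, \<open>\<mu>\<close>, \<open>n\<close> are kept as real (half-integral) numbers.\<close>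

definition is_label :: "real \<Rightarrow> real \<Rightarrow> real \<Rightarrow> arrow \<Rightarrow> bool" where
  "is_label j \<mu> n s \<longleftrightarrow> 2 * j \<in> \<nat> \<and> j + \<mu> \<in> \<nat> \<and> j - \<mu> \<in> \<nat> \<and>
     (case s of
        Up \<Rightarrow> (j + 1/2) + n \<in> \<nat> \<and> (j + 1/2) - n \<in> \<nat>
      | Down \<Rightarrow> (j - 1/2) + n \<in> \<nat> \<and> (j - 1/2) - n \<in> \<nat>)"

typedef label = "{(j, \<mu>, n, s). is_label j \<mu> n s}"
  by (rule exI[of _ "(0, 0, 1/2, Up)"]) (simp add: is_label_def)

type_synonym hspace = "label ell2"

definition ket :: "real \<Rightarrow> real \<Rightarrow> real \<Rightarrow> arrow \<Rightarrow> hspace" where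
  "ket j \<mu> n s = (if is_label j \<mu> n s then ell2_unit (Abs_label (j, \<mu>, n, s)) else 0)"

definition qnum :: "real \<Rightarrow> real \<Rightarrow> real" where
  "qnum q k = (q powr (-k) - q powr k) / (inverse q - q)"

text \<open>Two-by-two matrices, listed row by row.\<close>

datatype 'a mat2 = Mat2 'a 'a 'a 'a

fun mat2_entry :: "'a mat2 \<Rightarrow> arrow \<Rightarrow> arrow \<Rightarrow> 'a" where
  "mat2_entry (Mat2 uu ud du dd) Up Up = uu"
| "mat2_entry (Mat2 uu ud du dd) Up Down = ud"
| "mat2_entry (Mat2 uu ud du dd) Down Up = du"
| "mat2_entry (Mat2 uu ud du dd) Down Down = dd"

text \<open>The entry \<open>s t\<close> is the coefficient from source \<open>t\<close> to target \<open>s\<close>; a column is only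
  used at labels carrying its source arrow, where no denominator vanishes and no radicand
  is negative.\<close>

definition alpha_plus :: "real \<Rightarrow> real \<Rightarrow> real \<Rightarrow> real \<Rightarrow> real mat2" where
  "alpha_plus q j \<mu> n =
     map_mat2 ((*) (q powr ((\<mu> + n - 1/2) / 2) * sqrt (qnum q (j + \<mu> + 1))))
       (Mat2
         (q powr (-j - 1/2) * sqrt (qnum q (j + n + 3/2)) / qnum q (2*j + 2))
         0
         (q powr (1/2) * sqrt (qnum q (j - n + 1/2)) / (qnum q (2*j + 1) * qnum q (2*j + 2)))
         (q powr (-j) * sqrt (qnum q (j + n + 1/2)) / qnum q (2*j + 1)))"

definition alpha_minus :: "real \<Rightarrow> real \<Rightarrow> real \<Rightarrow> real \<Rightarrow> real mat2" where
  "alpha_minus q j \<mu> n =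
     map_mat2 ((*) (q powr ((\<mu> + n - 1/2) / 2) * sqrt (qnum q (j - \<mu>))))
       (Mat2
         (q powr (j + 1) * sqrt (qnum q (j - n + 1/2)) / qnum q (2*j + 1))
         (- (q powr (1/2) * sqrt (qnum q (j + n + 1/2)) / (qnum q (2*j) * qnum q (2*j + 1))))
         0
         (q powr (j + 1/2) * sqrt (qnum q (j - n - 1/2)) / qnum q (2*j)))"

definition beta_plus :: "real \<Rightarrow> real \<Rightarrow> real \<Rightarrow> real \<Rightarrow> real mat2" where
  "beta_plus q j \<mu> n =
     map_mat2 ((*) (q powr ((\<mu> + n - 1/2) / 2) * sqrt (qnum q (j + \<mu> + 1))))
       (Mat2
         (sqrt (qnum q (j - n + 3/2)) / qnum q (2*j + 2))
         0
         (- (q powr (-j - 1) * sqrt (qnum q (j + n + 1/2)) / (qnum q (2*j + 1) * qnum q (2*j + 2))))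
         (q powr (-1/2) * sqrt (qnum q (j - n + 1/2)) / qnum q (2*j + 1)))"

definition beta_minus :: "real \<Rightarrow> real \<Rightarrow> real \<Rightarrow> real \<Rightarrow> real mat2" where
  "beta_minus q j \<mu> n =
     map_mat2 ((*) (q powr ((\<mu> + n - 1/2) / 2) * sqrt (qnum q (j - \<mu>))))
       (Mat2
         (- (q powr (-1/2) * sqrt (qnum q (j + n + 1/2)) / qnum q (2*j + 1)))
         (- (q powr j * sqrt (qnum q (j - n + 1/2)) / (qnum q (2*j) * qnum q (2*j + 1))))
         0
         (- (sqrt (qnum q (j + n - 1/2)) / qnum q (2*j))))"

definition is_pi' :: "real \<Rightarrow> (suq2_elem \<Rightarrow> hspace \<Rightarrow> hspace) \<Rightarrow> bool" where
  "is_pi' q \<rho> \<longleftrightarrow> suq2_star_rep q \<rho> \<and>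
     (\<forall>j \<mu> n. is_label j \<mu> n Up \<longrightarrow>
        \<rho> (suq2_class q GenA) (ket j \<mu> n Up) =
            mat2_entry (alpha_plus q j \<mu> n) Up Up *\<^sub>R ket (j + 1/2) (\<mu> + 1/2) (n + 1/2) Up
          + mat2_entry (alpha_plus q j \<mu> n) Down Up *\<^sub>R ket (j + 1/2) (\<mu> + 1/2) (n + 1/2) Down
          + mat2_entry (alpha_minus q j \<mu> n) Up Up *\<^sub>R ket (j - 1/2) (\<mu> + 1/2) (n + 1/2) Up
      \<and> \<rho> (suq2_class q GenB) (ket j \<mu> n Up) =
            mat2_entry (beta_plus q j \<mu> n) Up Up *\<^sub>R ket (j + 1/2) (\<mu> + 1/2) (n - 1/2) Up
          + mat2_entry (beta_plus q j \<mu> n) Down Up *\<^sub>R ket (j + 1/2) (\<mu> + 1/2) (n - 1/2) Down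
          + mat2_entry (beta_minus q j \<mu> n) Up Up *\<^sub>R ket (j - 1/2) (\<mu> + 1/2) (n - 1/2) Up) \<and>
     (\<forall>j \<mu> n. is_label j \<mu> n Down \<longrightarrow>
        \<rho> (suq2_class q GenA) (ket j \<mu> n Down) =
            mat2_entry (alpha_plus q j \<mu> n) Down Down *\<^sub>R ket (j + 1/2) (\<mu> + 1/2) (n + 1/2) Down
          + mat2_entry (alpha_minus q j \<mu> n) Down Down *\<^sub>R ket (j - 1/2) (\<mu> + 1/2) (n + 1/2) Down
          + mat2_entry (alpha_minus q j \<mu> n) Up Down *\<^sub>R ket (j - 1/2) (\<mu> + 1/2) (n + 1/2) Up
      \<and> \<rho> (suq2_class q GenB) (ket j \<mu> n Down) =
            mat2_entry (beta_plus q j \<mu> n) Down Down *\<^sub>R ket (j + 1/2) (\<mu> + 1/2) (n - 1/2) Down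
          + mat2_entry (beta_minus q j \<mu> n) Down Down *\<^sub>R ket (j - 1/2) (\<mu> + 1/2) (n - 1/2) Down
          + mat2_entry (beta_minus q j \<mu> n) Up Down *\<^sub>R ket (j - 1/2) (\<mu> + 1/2) (n - 1/2) Up)"

definition F_op :: "hspace \<Rightarrow> hspace" where
  "F_op = diag_op (\<lambda>l. case Rep_label l of (j, \<mu>, n, s) \<Rightarrow> (case s of Up \<Rightarrow> 1 | Down \<Rightarrow> -1))"

definition K_weight :: "real \<Rightarrow> label \<Rightarrow> real" where
  "K_weight q l = (case Rep_label l of (j, \<mu>, n, s) \<Rightarrow> q powr (-2 * (\<mu> + n)))"

abbreviation K_dom :: "real \<Rightarrow> hspace set" where
  "K_dom q \<equiv> diag_dom (K_weight q)"

abbreviation K_op :: "real \<Rightarrow> hspace \<Rightarrow> hspace" where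
  "K_op q \<equiv> diag_op (K_weight q)"

text \<open>The tensor product of the Hilbert space with \<open>\<complex>\<^sup>2\<close> is its orthogonal direct sum with
  itself.\<close>

definition Ktilde_dom :: "real \<Rightarrow> (hspace \<times> hspace) set" where
  "Ktilde_dom q = K_dom q \<times> K_dom q"

definition Ktilde :: "real \<Rightarrow> hspace \<times> hspace \<Rightarrow> hspace \<times> hspace" where
  "Ktilde q = (\<lambda>(x, y). (inverse q *\<^sub>R K_op q x, q *\<^sub>R K_op q y))"

definition E_proj :: "hspace \<times> hspace \<Rightarrow> hspace \<times> hspace" where
  "E_proj = (\<lambda>(x, y). ((1/2) *\<^sub>R (x + F_op x), (1/2) *\<^sub>R (y + F_op y)))"

fun mat2_op :: "(suq2_elem \<Rightarrow> 'h \<Rightarrow> 'h) \<Rightarrow> suq2_elem mat2 \<Rightarrow> 'h \<times> 'h \<Rightarrow> 'h::chilbert_space \<times> 'h" where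
  "mat2_op \<rho> (Mat2 a b c d) (x, y) = (\<rho> a x + \<rho> b y, \<rho> c x + \<rho> d y)"

definition V_mat :: "real \<Rightarrow> suq2_elem mat2" where
  "V_mat q = Mat2
     (suq2_class q (Scale (of_real (-q)) (Star GenB))) (suq2_class q (Star GenA))
     (suq2_class q GenA)                               (suq2_class q GenB)"

end

theory Submission
  imports Defs
begin

text \<open>Let \<open>W = V\<^sup>*\<close>. On the range of \<open>E\<close> the kernel of \<open>E V E\<close> is governed by the off-diagonal
  part \<open>(1 - E) V E\<close>, because \<open>V\<close> is unitary; likewise the cokernel by \<open>(1 - E) W E\<close>. In the given
  basis both off-diagonal parts split into blocks of rank one: \<open>(1 - E) V E\<close> sends the span of
  \<open>(|j \<mu> n \<up>\<rangle>, 0)\<close> and \<open>(0, |j \<mu> n+1 \<up>\<rangle>)\<close> to the span of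
  \<open>(|j+1/2 \<mu>-1/2 n+1/2 \<down>\<rangle>, 0)\<close> and \<open>(0, |j+1/2 \<mu>+1/2 n+1/2 \<down>\<rangle>)\<close> with norm
  \<open>1 / [2j+1]\<close>, and \<open>(1 - E) W E\<close> behaves similarly with norm \<open>1 / [2j+2]\<close>. As \<open>[k] \<ge> 2\<close> for
  \<open>k \<ge> 2\<close>, both are bounded by \<open>1/2\<close>, except for the single block \<open>j = \<mu> = 0\<close>, \<open>n = -1/2\<close> of
  \<open>V\<close>, which has norm \<open>1\<close>. So the cokernel vanishes and the kernel is a line, on which
  \<open>K\<close> (tensored with the diagonal matrix) acts as \<open>1\<close>.\<close>

section \<open>The modular index through off-diagonal blocks\<close>

lemma cinner_add_right: "cinner x (y + z) = cinner x y + cinner x z"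
  for x y z :: "'h::complex_inner"
  by (metis cinner_add_left cinner_commute complex_cnj_add)

lemma cinner_scaleC_right: "cinner x (c *\<^sub>C y) = c * cinner x y"
  for x y :: "'h::complex_inner"
  by (metis cinner_commute cinner_scaleC_left complex_cnj_cnj complex_cnj_mult)

lemma scaleR_eq_scaleC: "r *\<^sub>R x = of_real r *\<^sub>C x" for x :: "'h::complex_inner"
  by (simp add: scaleC_of_real)

lemma cinner_scaleR_left: "cinner (r *\<^sub>R x) y = of_real r * cinner x y"
  and cinner_scaleR_right: "cinner x (r *\<^sub>R y) = of_real r * cinner x y"
  for x y :: "'h::complex_inner"
  by (simp_all add: scaleR_eq_scaleC cinner_scaleC_left cinner_scaleC_right)

lemma scaleC_zero_left [simp]: "0 *\<^sub>C x = 0" for x :: "'h::complex_inner"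
  using scaleC_of_real[of 0 x] by simp

lemma scaleC_one [simp]: "1 *\<^sub>C x = x" for x :: "'h::complex_inner"
  using scaleC_of_real[of 1 x] by simp

lemma scaleC_zero_right [simp]: "c *\<^sub>C 0 = (0 :: 'h::complex_inner)"
  using scaleC_scaleC[of c 0 0] by simp

lemma cinner_zero_left [simp]: "cinner 0 y = 0" and cinner_zero_right [simp]: "cinner y 0 = 0"
  for y :: "'h::complex_inner"
  using cinner_scaleR_left[of 0 0 y] cinner_scaleR_right[of y 0 0] by simp_all

lemma cinner_diff_left: "cinner (x - y) z = cinner x z - cinner y z"
  and cinner_diff_right: "cinner z (x - y) = cinner z x - cinner z y"
  for x y z :: "'h::complex_inner"
  using cinner_add_left[of "x - y" y z] cinner_add_right[of z "x - y" y] by simp_all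

lemma cinner_self: "cinner x x = of_real ((norm x)\<^sup>2)" for x :: "'h::complex_inner"
proof -
  have "Im (cinner x x) = 0"
    by (metis cinner_commute cnj.simps(2) equal_neg_zero)
  moreover have "Re (cinner x x) = (norm x)\<^sup>2"
    by (simp add: power2_norm_eq_inner inner_eq_Re_cinner)
  ultimately show ?thesis by (simp add: complex_eq_iff)
qed

lemma norm_sq_eq_cinner: "(norm x)\<^sup>2 = Re (cinner x x)" for x :: "'h::complex_inner"
  by (simp add: cinner_self)

lemma cinner_extensionality:
  fixes x y :: "'h::complex_inner"
  assumes "\<And>z. cinner z x = cinner z y"
  shows "x = y"
proof -
  have "cinner (x - y) (x - y) = 0"
    by (simp add: cinner_diff_right assms)
  then show ?thesis by (simp add: cinner_self)
qed

text \<open>Pythagoras for the component of z orthogonal to u. It yields Cauchy-Schwarz below and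
  later shows that kernel vectors are multiples of a single vector.\<close>

lemma norm_diff_proj_sq:
  fixes u z :: "'h::complex_inner"
  assumes "norm u = 1"
  shows "(norm (z - cinner u z *\<^sub>C u))\<^sup>2 = (norm z)\<^sup>2 - (cmod (cinner u z))\<^sup>2"
proof -
  have "cinner (z - cinner u z *\<^sub>C u) (z - cinner u z *\<^sub>C u)
      = cinner z z - cinner u z * cinner z u"
    using assms by (simp add: cinner_diff_left cinner_diff_right cinner_scaleC_left
        cinner_scaleC_right cinner_self[of u] algebra_simps)
  also have "\<dots> = of_real ((norm z)\<^sup>2 - (cmod (cinner u z))\<^sup>2)"
    using complex_norm_square[of "cinner u z"]
    by (subst cinner_commute[of z u]) (simp add: cinner_self)
  finally show ?thesis by (metis Re_complex_of_real norm_sq_eq_cinner)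
qed

lemma cmod_cinner_le: "cmod (cinner x y) \<le> norm x * norm y" for x y :: "'h::complex_inner"
proof (cases "x = 0")
  case False
  define u where "u = inverse (norm x) *\<^sub>R x"
  have u: "norm u = 1" "x = norm x *\<^sub>R u" using False by (simp_all add: u_def)
  have "(cmod (cinner u y))\<^sup>2 \<le> (norm y)\<^sup>2"
    using norm_diff_proj_sq[OF u(1), of y] zero_le_power2[of "norm (y - cinner u y *\<^sub>C u)"]
    by linarith
  then have "cmod (cinner u y) \<le> norm y" by (simp add: power2_le_iff_abs_le)
  then show ?thesis
    by (subst u(2)) (simp add: cinner_scaleR_left norm_mult mult_left_mono)
qed simp

lemma bounded_linear_cinner_right: "bounded_linear (cinner x)" for x :: "'h::complex_inner"
proof (rule bounded_linear_intro)
  show "norm (cinner x y) \<le> norm y * norm x" for y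
    using cmod_cinner_le[of x y] by (simp add: mult.commute)
qed (simp_all add: cinner_add_right cinner_scaleR_right scaleR_conv_of_real)

section \<open>Adjoints and bounded complex-linear maps\<close>

text \<open>\<open>cadjoint\<close> is chosen by \<open>SOME\<close>, but the inner product
  separates points, so any map satisfying the adjoint relation is the chosen one.\<close>

lemma cadjoint_eqI:
  assumes "\<And>x y. cinner (A x) y = cinner x (B y)" shows "cadjoint A = B"
proof
  fix y
  have "\<exists>B. \<forall>x y. cinner (A x) y = cinner x (B y)" using assms by blast
  then have "\<forall>x y. cinner (A x) y = cinner x (cadjoint A y)"
    unfolding cadjoint_def by (rule someI_ex)
  then show "cadjoint A y = B y"
    using assms by (intro cinner_extensionality) metis
qed

lemma bounded_clinearD:
  assumes "bounded_clinear A"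
  shows "bounded_linear A" "A (c *\<^sub>C x) = c *\<^sub>C A x" "A (x + y) = A x + A y"
    "A (x - y) = A x - A y" "A (r *\<^sub>R x) = r *\<^sub>R A x" "A 0 = 0"
proof -
  show b: "bounded_linear A" using assms by (simp add: bounded_clinear_def)
  show "A (c *\<^sub>C x) = c *\<^sub>C A x" using assms by (simp add: bounded_clinear_def)
  interpret bounded_linear A by (rule b)
  show "A (x + y) = A x + A y" "A (x - y) = A x - A y" "A (r *\<^sub>R x) = r *\<^sub>R A x" "A 0 = 0"
    by (simp_all add: add diff scaleR zero)
qed

lemma bounded_clinear_compose:
  assumes "bounded_clinear A" "bounded_clinear B" shows "bounded_clinear (A \<circ> B)"
  using assms bounded_linear_compose[of A B] by (simp add: bounded_clinear_def o_def)

section \<open>Spans, and traces on subspaces of dimension zero and one\<close>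

lemma cspan_empty: "cspan {} = {0}"
  by (auto simp: cspan_def)

lemma cspan_singleton: "cspan {x} = range (\<lambda>c. c *\<^sub>C x)"
proof
  show "cspan {x} \<subseteq> range (\<lambda>c. c *\<^sub>C x)"
  proof
    fix y assume "y \<in> cspan {x}"
    then obtain t c where t: "t \<subseteq> {x}" and y: "y = (\<Sum>b\<in>t. c b *\<^sub>C b)" by (auto simp: cspan_def)
    from t have "t = {} \<or> t = {x}" by blast
    then have "y = 0 *\<^sub>C x \<or> y = c x *\<^sub>C x" using y by auto
    then show "y \<in> range (\<lambda>c. c *\<^sub>C x)" by blast
  qed
  have "c *\<^sub>C x \<in> cspan {x}" for c
    unfolding cspan_def by (intro CollectI exI[of _ "{x}"] exI[of _ "\<lambda>_. c"]) simp
  then show "range (\<lambda>c. c *\<^sub>C x) \<subseteq> cspan {x}" by blast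
qed

lemma mem_cspan: "x \<in> B \<Longrightarrow> x \<in> cspan B"
proof -
  assume x: "x \<in> B"
  have "x = (\<Sum>b\<in>{x}. 1 *\<^sub>C b)" by simp
  with x show ?thesis unfolding cspan_def
    by (intro CollectI exI[of _ "{x}"] exI[of _ "\<lambda>_. 1"]) simp
qed

text \<open>\<open>trace_on\<close> evaluates on an unspecified orthonormal basis, so the sum has to
  be known for every basis, and one basis has to exist.\<close>

lemma trace_on_eqI:
  assumes "onb_of B S" and "\<And>B. onb_of B S \<Longrightarrow> (\<Sum>b\<in>B. cinner b (L b)) = m"
  shows "trace_on L S = m"
  unfolding trace_on_def by (rule someI2[of "\<lambda>B. onb_of B S", OF assms])

lemma trace_on_zero: "trace_on L {0} = 0"
proof (rule trace_on_eqI)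
  show "onb_of {} {0}" by (simp add: onb_of_def cspan_empty)
  fix B :: "'a set" assume B: "onb_of B {0}"
  have "b = 0" if "b \<in> B" for b using B mem_cspan[OF that] by (simp add: onb_of_def)
  moreover have "b \<noteq> 0" if "b \<in> B" for b
  proof
    have "cinner b b = 1" using B that by (simp add: onb_of_def)
    moreover assume "b = 0"
    ultimately show False by simp
  qed
  ultimately have "B = {}" by blast
  then show "(\<Sum>b\<in>B. cinner b (L b)) = 0" by simp
qed

lemma trace_on_line:
  fixes u :: "'h::complex_inner"
  assumes u: "norm u = 1" and L: "\<And>c. L (c *\<^sub>C u) = c *\<^sub>C u"
  shows "trace_on L (range (\<lambda>c. c *\<^sub>C u)) = 1"
proof (rule trace_on_eqI)
  show "onb_of {u} (range (\<lambda>c. c *\<^sub>C u))"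
    using u by (simp add: onb_of_def cspan_singleton cinner_self)
  fix B assume B: "onb_of B (range (\<lambda>c. c *\<^sub>C u))"
  have mult: "\<exists>c. b = c *\<^sub>C u" if "b \<in> B" for b
    using B mem_cspan[OF that] by (auto simp: onb_of_def)
  have one: "cinner b b = 1" if "b \<in> B" for b using B that by (simp add: onb_of_def)
  have "B \<noteq> {}"
  proof
    assume "B = {}"
    then have "u \<in> {0}" using B rangeI[of "\<lambda>c. c *\<^sub>C u" 1]
      by (simp add: onb_of_def cspan_empty)
    then show False using u by simp
  qed
  then obtain b where b: "b \<in> B" by blast
  have "b' = b" if "b' \<in> B" for b'
  proof (rule ccontr)
    assume "b' \<noteq> b"
    then have z: "cinner b b' = 0" using B b that by (auto simp: onb_of_def)
    obtain c c' where c: "b = c *\<^sub>C u" "b' = c' *\<^sub>C u" using mult[OF b] mult[OF \<open>b' \<in> B\<close>] by blast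
    \<comment> \<open>Two multiples of the same unit vector are orthogonal only if one of them is
      0.\<close>
    have "cnj c * c' = 0" using z u by (auto simp: c cinner_scaleC_left cinner_scaleC_right cinner_self)
    then have "cinner b b = 0 \<or> cinner b' b' = 0" by (auto simp: c)
    then show False using one b that by auto
  qed
  then have "B = {b}" using b by blast
  moreover have "L b = b" using mult[OF b] L by auto
  ultimately show "(\<Sum>b\<in>B. cinner b (L b)) = 1" using one[OF b] by simp
qed

section \<open>An abstract criterion for modular index 1\<close>

locale orthogonal_projection =
  fixes E :: "'h::chilbert_space \<Rightarrow> 'h"
  assumes bounded: "bounded_clinear E"
    and idem: "E (E z) = E z"
    and selfadjoint: "cinner (E z) w = cinner z (E w)"
begin

lemma pythagoras: "(norm z)\<^sup>2 = (norm (E z))\<^sup>2 + (norm (z - E z))\<^sup>2"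
proof -
  have "cinner (z - E z) (z - E z) = cinner z z - cinner (E z) (E z)"
    by (simp add: cinner_diff_left cinner_diff_right selfadjoint idem)
  then show ?thesis by (simp add: norm_sq_eq_cinner)
qed

text \<open>V is isometric, so the squared norm of z splits into that of E (V z) and that of the
  off-diagonal part; an upper bound on the latter is a lower bound on the former. The constants 1/4
  and 3/4 add up to 1: the vector u may be lost entirely, while orthogonally to u at least 3/4 of
  the squared norm survives. The bound for W makes E W injective on the range of E, which removes
  the cokernel.\<close>

lemma has_modular_index_one:
  assumes V: "bounded_clinear V" and adj: "\<And>z w. cinner (V z) w = cinner z (W w)"
    and W: "bounded_clinear W"
    and WV: "\<And>z. W (V z) = z" and VW: "\<And>z. V (W z) = z"
    and comm: "commutes_with_unbounded V D K"
    and u: "norm u = 1" "E u = u"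
    and fixed: "\<And>c. c *\<^sub>C u \<in> D" "\<And>c. K (c *\<^sub>C u) = c *\<^sub>C u"
    and off: "\<And>z. E z = z \<Longrightarrow>
        (norm (V z - E (V z)))\<^sup>2 \<le> (norm z)\<^sup>2 / 4 + 3/4 * (cmod (cinner u z))\<^sup>2"
    and off_u: "norm (V u - E (V u)) \<ge> 1"
    and off_adj: "\<And>z. E z = z \<Longrightarrow> (norm (W z - E (W z)))\<^sup>2 \<le> (norm z)\<^sup>2 / 4"
  shows "has_modular_index D K E V 1"
proof -
  have cad: "cadjoint V = W" by (rule cadjoint_eqI) (rule adj)
  have normV: "norm (V z) = norm z" for z
  proof -
    have "cinner (V z) (V z) = cinner z z" by (simp add: adj WV)
    then have "(norm (V z))\<^sup>2 = (norm z)\<^sup>2" by (simp add: norm_sq_eq_cinner)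
    then show ?thesis by simp
  qed
  have normW: "norm (W z) = norm z" for z
    using normV[of "W z"] by (simp add: VW)
  have "unitary_op V"
    using V by (auto simp: unitary_op_def cad WV VW)
  define T where "T = E \<circ> V \<circ> E \<circ> cadjoint V"
  define S where "S = E \<circ> V"
  define X where "X = range (V \<circ> E)"
  define u' where "u' = V u"
  have S: "bounded_clinear S" unfolding S_def by (intro bounded_clinear_compose V bounded)
  have T: "bounded_clinear T" unfolding T_def cad
    by (intro bounded_clinear_compose V W bounded)
  \<comment> \<open>Elements of X have the form V (E z), so T on X is the compression S read on the
    range of E.\<close>
  have TV: "T (V (E z)) = S (E z)" for z by (simp add: T_def S_def cad WV idem)
  have lower: "3/4 * ((norm z)\<^sup>2 - (cmod (cinner u z))\<^sup>2) \<le> (norm (S z))\<^sup>2" if "E z = z" for z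
  proof -
    have "(norm z)\<^sup>2 = (norm (S z))\<^sup>2 + (norm (V z - E (V z)))\<^sup>2"
      using pythagoras[of "V z"] by (simp add: S_def normV)
    then show ?thesis using off[OF that] by argo
  qed
  have Su: "S u = 0"
  proof -
    \<comment> \<open>The off-diagonal part already exhausts the norm of the unit vector V u, which
      leaves nothing for S u.\<close>
    have "1 \<le> (norm (V u - E (V u)))\<^sup>2" using off_u by simp
    moreover have "1 = (norm (S u))\<^sup>2 + (norm (V u - E (V u)))\<^sup>2"
      using pythagoras[of "V u"] by (simp add: S_def normV u)
    ultimately have "(norm (S u))\<^sup>2 \<le> 0" by linarith
    then show ?thesis by simp
  qed
  have Ecu: "E (c *\<^sub>C u) = c *\<^sub>C u" for c by (simp add: bounded_clinearD(2)[OF bounded] u)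
  have ker: "op_ker T X = range (\<lambda>c. c *\<^sub>C u')"
  proof (intro equalityI subsetI)
    fix x assume "x \<in> op_ker T X"
    then obtain z where x: "x = V (E z)" and "T x = 0" by (auto simp: op_ker_def X_def)
    then have "S (E z) = 0" by (simp add: TV)
    then have "(norm (E z - cinner u (E z) *\<^sub>C u))\<^sup>2 \<le> 0"
      using lower[of "E z"] by (simp add: idem norm_diff_proj_sq[OF u(1)])
    then have "E z = cinner u (E z) *\<^sub>C u" by simp
    then have "x = cinner u (E z) *\<^sub>C u'"
      unfolding x u'_def by (metis bounded_clinearD(2)[OF V])
    then show "x \<in> range (\<lambda>c. c *\<^sub>C u')" by blast
  next
    fix x assume "x \<in> range (\<lambda>c. c *\<^sub>C u')"
    then obtain c where "x = V (E (c *\<^sub>C u))"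
      by (auto simp: u'_def bounded_clinearD(2)[OF V] Ecu)
    moreover have "S (E (c *\<^sub>C u)) = 0"
      unfolding Ecu by (simp add: bounded_clinearD(2)[OF S] Su)
    ultimately show "x \<in> op_ker T X" using TV by (auto simp: op_ker_def X_def)
  qed
  have coker: "op_coker T X (range E) = {0}"
  proof (intro equalityI subsetI)
    fix y assume "y \<in> op_coker T X (range E)"
    then have y: "E y = y" and ann: "\<And>x. x \<in> X \<Longrightarrow> cinner (T x) y = 0"
      by (auto simp: op_coker_def idem)
    have "cinner z (E (W y)) = 0" for z
    proof -
      have "cinner (S (E z)) y = 0" using ann[of "V (E z)"] by (simp add: TV X_def)
      then show ?thesis by (simp add: S_def selfadjoint adj y)
    qed
    then have "E (W y) = 0" by (intro cinner_extensionality) simp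
    then have "(norm y)\<^sup>2 \<le> (norm y)\<^sup>2 / 4" using off_adj[OF y] by (simp add: normW)
    then show "y \<in> {0}" by simp
  next
    fix y :: 'h assume "y \<in> {0}"
    then show "y \<in> op_coker T X (range E)"
      using bounded_clinearD(6)[OF bounded] by (auto simp: op_coker_def intro: range_eqI[of _ _ 0])
  qed
  \<comment> \<open>The line of u does not contribute to the image. Without it S is bounded below,
    and a bounded-below image of a complete subspace is complete.\<close>
  have im: "T ` X = S ` {z. E z = z \<and> cinner u z = 0}"
  proof (intro equalityI subsetI)
    fix y assume "y \<in> T ` X"
    then obtain z where y: "y = S (E z)" by (auto simp: X_def TV)
    define w where "w = E z - cinner u (E z) *\<^sub>C u"
    have "E w = w" by (simp add: w_def bounded_clinearD[OF bounded] idem u)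
    moreover have "cinner u w = 0"
      by (simp add: w_def cinner_diff_right cinner_scaleC_right cinner_self[of u] u)
    moreover have "S w = y" by (simp add: w_def y bounded_clinearD[OF S] Su)
    ultimately show "y \<in> S ` {z. E z = z \<and> cinner u z = 0}" by blast
  next
    fix y assume "y \<in> S ` {z. E z = z \<and> cinner u z = 0}"
    then obtain z where z: "y = S z" "E z = z" by blast
    then have "y = T (V (E z))" using TV[of z] by simp
    moreover have "V (E z) \<in> X" by (simp add: X_def)
    ultimately show "y \<in> T ` X" by blast
  qed
  have "closed (T ` X)"
    unfolding im
  proof (rule complete_imp_closed, rule complete_isometric_image)
    \<comment> \<open>The available lower bound is the square root of 3/4; the cruder 1/2 is
      enough.\<close>
    show "0 < (1/2 :: real)" by simp
    show "bounded_linear S" by (rule bounded_clinearD(1)[OF S])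
    show "subspace {z. E z = z \<and> cinner u z = 0}"
      by (auto simp: subspace_def bounded_clinearD[OF bounded] cinner_add_right cinner_scaleR_right)
    show "\<forall>z\<in>{z. E z = z \<and> cinner u z = 0}. 1/2 * norm z \<le> norm (S z)"
    proof safe
      fix z assume "E z = z" "cinner u z = 0"
      then have "3/4 * (norm z)\<^sup>2 \<le> (norm (S z))\<^sup>2" using lower[of z] by simp
      moreover have "(1/2 * norm z)\<^sup>2 = (norm z)\<^sup>2 / 4"
        by (simp add: power_mult_distrib power_divide)
      ultimately have "(1/2 * norm z)\<^sup>2 \<le> (norm (S z))\<^sup>2"
        using zero_le_power2[of "norm z"] by linarith
      then show "1/2 * norm z \<le> norm (S z)" by (rule power2_le_imp_le) simp
    qed
    have "continuous_on UNIV E" "continuous_on UNIV (cinner u)"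
      by (intro linear_continuous_on bounded_clinearD(1)[OF bounded] bounded_linear_cinner_right)+
    then have "closed ({z. E z = z} \<inter> {z. cinner u z = 0})"
      by (intro closed_Int closed_Collect_eq continuous_intros)
    then show "complete {z. E z = z \<and> cinner u z = 0}"
      by (simp add: complete_eq_closed Collect_conj_eq)
  qed
  have "fredholm_between T X (range E)"
    unfolding fredholm_between_def
  proof (intro conjI T \<open>closed (T ` X)\<close>)
    show "T ` X \<subseteq> range E" by (auto simp: T_def)
    show "finite_cdim (op_ker T X)" unfolding ker finite_cdim_def
      by (intro exI[of _ "{u'}"]) (simp add: cspan_singleton)
    show "finite_cdim (op_coker T X (range E))" unfolding coker finite_cdim_def
      by (intro exI[of _ "{}"]) (simp add: cspan_empty)
  qed
  have Vcu: "c *\<^sub>C u' = V (c *\<^sub>C u)" for c by (simp add: u'_def bounded_clinearD(2)[OF V])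
  have inD: "c *\<^sub>C u' \<in> D" for c
    unfolding Vcu using comm fixed(1) by (auto simp: commutes_with_unbounded_def)
  \<comment> \<open>K commutes with V and fixes every multiple of u, so it fixes the multiples of V
    u that form the kernel.\<close>
  have K: "K (c *\<^sub>C u') = c *\<^sub>C u'" for c
    unfolding Vcu using comm fixed by (metis commutes_with_unbounded_def)
  have "norm u' = 1" by (simp add: u'_def normV u)
  then have "trace_on K (op_ker T X) = 1" unfolding ker by (intro trace_on_line K)
  then show ?thesis
    unfolding has_modular_index_def Let_def T_def[symmetric] X_def[symmetric]
    using \<open>unitary_op V\<close> comm \<open>fredholm_between T X (range E)\<close> inD[of 0] K[of 0]
    by (auto simp: coker trace_on_zero) (auto simp: ker inD K)
qed

end

section \<open>Diagonal operators\<close>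

lemma coord_ell2_unit: "coord (ell2_unit x) y = (if y = x then 1 else 0)"
proof -
  have "(\<lambda>y. (cmod (if y = x then 1 else 0))\<^sup>2) summable_on UNIV"
    by (rule has_sum_imp_summable[OF has_sum_finite_neutralI[of "{x}"]]) auto
  then show ?thesis by (simp add: ell2_unit_def Abs_ell2_inverse)
qed

lemma cinner_ell2_unit: "cinner (ell2_unit x) \<psi> = coord \<psi> x"
proof -
  have "((\<lambda>y. cnj (coord (ell2_unit x) y) * coord \<psi> y) has_sum coord \<psi> x) UNIV"
    by (rule has_sum_finite_neutralI[of "{x}"]) (auto simp: coord_ell2_unit)
  then show ?thesis by (simp add: cinner_ell2_def infsumI)
qed

lemma coord_diag_op:
  assumes "\<psi> \<in> diag_dom d" shows "coord (diag_op d \<psi>) x = of_real (d x) * coord \<psi> x"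
  using assms by (simp add: diag_dom_def diag_op_def Abs_ell2_inverse)

lemma diag_dom_bounded:
  assumes "\<And>x. \<bar>d x\<bar> \<le> 1" shows "\<psi> \<in> diag_dom d"
  unfolding diag_dom_def
proof (rule CollectI, rule summable_on_comparison_test[OF coord_summable[of \<psi>]])
  fix x
  have "\<bar>d x\<bar> * cmod (coord \<psi> x) \<le> 1 * cmod (coord \<psi> x)"
    by (intro mult_right_mono assms) simp
  then show "(cmod (of_real (d x) * coord \<psi> x))\<^sup>2 \<le> (cmod (coord \<psi> x))\<^sup>2"
    by (intro power_mono) (simp_all add: norm_mult)
qed auto

lemma diag_dom_add: "\<phi> \<in> diag_dom d \<Longrightarrow> \<psi> \<in> diag_dom d \<Longrightarrow> \<phi> + \<psi> \<in> diag_dom d"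
  unfolding diag_dom_def by (auto simp: plus_ell2.rep_eq ring_distribs dest: ell2_add_summable)

lemma diag_dom_scaleC: "\<psi> \<in> diag_dom d \<Longrightarrow> c *\<^sub>C \<psi> \<in> diag_dom d"
  unfolding diag_dom_def
  by (auto simp: scaleC_ell2.rep_eq mult.left_commute dest: ell2_scale_summable[where c = c])

lemma diag_dom_scaleR: "\<psi> \<in> diag_dom d \<Longrightarrow> r *\<^sub>R \<psi> \<in> diag_dom d"
  by (simp add: scaleR_eq_scaleC diag_dom_scaleC)

lemma diag_op_add:
  "\<phi> \<in> diag_dom d \<Longrightarrow> \<psi> \<in> diag_dom d \<Longrightarrow> diag_op d (\<phi> + \<psi>) = diag_op d \<phi> + diag_op d \<psi>"
  by (intro ell2_eqI) (simp add: plus_ell2.rep_eq coord_diag_op diag_dom_add ring_distribs)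

lemma diag_op_scaleC: "\<psi> \<in> diag_dom d \<Longrightarrow> diag_op d (c *\<^sub>C \<psi>) = c *\<^sub>C diag_op d \<psi>"
  by (intro ell2_eqI) (simp add: scaleC_ell2.rep_eq coord_diag_op diag_dom_scaleC)

lemma diag_op_scaleR: "\<psi> \<in> diag_dom d \<Longrightarrow> diag_op d (r *\<^sub>R \<psi>) = r *\<^sub>R diag_op d \<psi>"
  by (simp add: scaleR_eq_scaleC diag_op_scaleC)

lemma ell2_unit_in_diag_dom: "ell2_unit x \<in> diag_dom d"
  unfolding diag_dom_def
  by (rule CollectI, rule has_sum_imp_summable[OF has_sum_finite_neutralI[of "{x}"]])
    (auto simp: coord_ell2_unit)

lemma diag_op_ell2_unit: "diag_op d (ell2_unit x) = d x *\<^sub>R ell2_unit x"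
  by (rule ell2_eqI)
    (auto simp: coord_diag_op ell2_unit_in_diag_dom scaleR_ell2.rep_eq coord_ell2_unit)

text \<open>Commutation with an unbounded diagonal operator is reduced to matrix entries. The
  adjoint B turns a coordinate of A v into a series in the coordinates of v, and the two series
  agree term by term. Since one side consists of the coordinates of an actual vector, membership of
  \<open>A \<psi>\<close> in the domain follows as well.\<close>

lemma diag_op_weight_shift:
  assumes adj: "\<And>v w. cinner (A v) w = cinner v (B w)"
    and shift: "\<And>k l. coord (A (ell2_unit k)) l \<noteq> 0 \<Longrightarrow> d l = r * d k"
    and \<psi>: "\<psi> \<in> diag_dom d"
  shows "A \<psi> \<in> diag_dom d" "diag_op d (A \<psi>) = r *\<^sub>R A (diag_op d \<psi>)"
proof -
  have coordA: "coord (A v) l = (\<Sum>\<^sub>\<infinity>k. cnj (coord (B (ell2_unit l)) k) * coord v k)" for v l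
  proof -
    have "coord (A v) l = cnj (cinner (A v) (ell2_unit l))"
      by (metis cinner_commute cinner_ell2_unit)
    also have "\<dots> = cinner (B (ell2_unit l)) v" by (metis adj cinner_commute)
    finally show ?thesis by (simp add: cinner_ell2_def)
  qed
  have "of_real (d l) * coord (A \<psi>) l = of_real r * coord (A (diag_op d \<psi>)) l" for l
    unfolding coordA infsum_cmult_right'[symmetric]
  proof (rule infsum_cong)
    fix k
    have "coord (B (ell2_unit l)) k = cnj (coord (A (ell2_unit k)) l)"
      by (metis adj cinner_commute cinner_ell2_unit)
    then have "d l = r * d k \<or> coord (B (ell2_unit l)) k = 0" using shift[of k l] by auto
    then show "of_real (d l) * (cnj (coord (B (ell2_unit l)) k) * coord \<psi> k) =
        of_real r * (cnj (coord (B (ell2_unit l)) k) * coord (diag_op d \<psi>) k)"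
      by (auto simp: coord_diag_op[OF \<psi>])
  qed
  then have eq: "(\<lambda>l. of_real (d l) * coord (A \<psi>) l) = coord (r *\<^sub>R A (diag_op d \<psi>))"
    by (simp add: scaleR_ell2.rep_eq)
  then show "A \<psi> \<in> diag_dom d"
    unfolding diag_dom_def using coord_summable[of "r *\<^sub>R A (diag_op d \<psi>)", folded eq] by simp
  then show "diag_op d (A \<psi>) = r *\<^sub>R A (diag_op d \<psi>)"
    by (intro ell2_eqI) (metis coord_diag_op eq)
qed

section \<open>Labels and basis vectors\<close>

definition arrow_of :: "label \<Rightarrow> arrow" where
  "arrow_of l = (case Rep_label l of (j, \<mu>, n, s) \<Rightarrow> s)"

lemma arrow_of_Abs: "is_label j \<mu> n s \<Longrightarrow> arrow_of (Abs_label (j, \<mu>, n, s)) = s"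
  by (simp add: arrow_of_def Abs_label_inverse)

lemma K_weight_Abs:
  "is_label j \<mu> n s \<Longrightarrow> K_weight q (Abs_label (j, \<mu>, n, s)) = q powr (-2 * (\<mu> + n))"
  by (simp add: K_weight_def Abs_label_inverse)

lemma label_cases:
  obtains j \<mu> n s where "is_label j \<mu> n s" "l = Abs_label (j, \<mu>, n, s)"
  by (cases l) auto

lemma label_half_or_zero:
  assumes "is_label j \<mu> n s" shows "j = 0 \<or> 1/2 \<le> j"
proof -
  from assms obtain k :: nat where "2 * j = real k" by (auto simp: is_label_def elim: Nats_cases)
  then show ?thesis by (cases k) auto
qed

lemma is_label_bounds:
  assumes "is_label j \<mu> n s"
  shows "0 \<le> j" "-j \<le> \<mu>" "\<mu> \<le> j" "-j - 1/2 \<le> n" "n \<le> j + 1/2"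
proof -
  have nn: "0 \<le> x" if "x \<in> \<nat>" for x :: real using that by (auto elim: Nats_cases)
  from assms have "2 * j \<in> \<nat>" "j + \<mu> \<in> \<nat>" "j - \<mu> \<in> \<nat>" by (simp_all add: is_label_def)
  from this[THEN nn] have "0 \<le> 2 * j" "0 \<le> j + \<mu>" "0 \<le> j - \<mu>" .
  then show "0 \<le> j" "-j \<le> \<mu>" "\<mu> \<le> j" by simp_all
  from assms have "(0 \<le> j + 1/2 + n \<and> 0 \<le> j + 1/2 - n) \<or> (0 \<le> j - 1/2 + n \<and> 0 \<le> j - 1/2 - n)"
    by (cases s) (auto simp: is_label_def dest!: nn)
  then show "-j - 1/2 \<le> n" "n \<le> j + 1/2" by auto
qed

text \<open>Here j - 1/2 = 0, so both n and -n are natural numbers. This is why n = -1/2 is the only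
  relevant value among the blocks of V with j = 0.\<close>

lemma Down_label_half:
  assumes "is_label (1/2) \<mu> n Down" shows "n = 0"
proof -
  from assms have "n \<in> \<nat>" "- n \<in> \<nat>" by (simp_all add: is_label_def)
  then have "0 \<le> n" "0 \<le> - n" by (auto elim: Nats_cases)
  then show ?thesis by simp
qed

lemma lowest_labels [simp]:
  "is_label 0 0 (-(1/2)) Up" "is_label 0 0 (1/2) Up"
  "is_label (1/2) (-(1/2)) 0 Down" "is_label (1/2) (1/2) 0 Down"
  by (simp_all add: is_label_def)

lemma cinner_ket:
  "cinner (ket j \<mu> n s) x = (if is_label j \<mu> n s then coord x (Abs_label (j, \<mu>, n, s)) else 0)"
  by (simp add: ket_def cinner_ell2_unit)

lemma cinner_ket_ket:
  "cinner (ket j \<mu> n s) (ket j' \<mu>' n' s') =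
    (if is_label j \<mu> n s \<and> (j', \<mu>', n', s') = (j, \<mu>, n, s) then 1 else 0)"
  by (auto simp: ket_def cinner_ell2_unit coord_ell2_unit Abs_label_inject)

lemma diag_op_K_ket:
  "ket j \<mu> n s \<in> K_dom q" "K_op q (ket j \<mu> n s) = (q powr (-2 * (\<mu> + n))) *\<^sub>R ket j \<mu> n s"
proof -
  \<comment> \<open>\<open>ket\<close> is 0 off the labels, so the eigenvalue equation has to cover
    the zero vector too.\<close>
  have 0: "0 \<in> diag_dom d" for d :: "label \<Rightarrow> real" by (simp add: diag_dom_def zero_ell2.rep_eq)
  then have "diag_op d 0 = 0" for d :: "label \<Rightarrow> real"
    by (intro ell2_eqI) (simp add: coord_diag_op zero_ell2.rep_eq)
  with 0 show "ket j \<mu> n s \<in> K_dom q"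
    "K_op q (ket j \<mu> n s) = (q powr (-2 * (\<mu> + n))) *\<^sub>R ket j \<mu> n s"
    by (simp_all add: ket_def ell2_unit_in_diag_dom diag_op_ell2_unit K_weight_Abs)
qed

section \<open>The projection onto the up vectors\<close>

text \<open>The orthogonal projection onto the closed span of the up vectors. \<open>E_proj\<close>
  applies it in each component, so estimates can be made one component at a time.\<close>

definition up_part :: "hspace \<Rightarrow> hspace" where
  "up_part x = (1/2) *\<^sub>R (x + F_op x)"

lemma E_proj_eq: "E_proj (x, y) = (up_part x, up_part y)"
  by (simp add: E_proj_def up_part_def)

lemma coord_up_part: "coord (up_part x) l = (if arrow_of l = Up then coord x l else 0)"
proof -
  obtain j \<mu> n s where s: "Rep_label l = (j, \<mu>, n, s)" by (metis prod_cases4)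
  \<comment> \<open>Coordinates of \<open>diag_op\<close> are known only on the domain, which is the
    whole space here because the entries are 1 and -1.\<close>
  have "x \<in> diag_dom (\<lambda>l. case Rep_label l of (j, \<mu>, n, s) \<Rightarrow> (case s of Up \<Rightarrow> 1 | Down \<Rightarrow> -1))"
    by (rule diag_dom_bounded) (auto split: prod.split arrow.split)
  from coord_diag_op[OF this, of l] show ?thesis
    by (cases s) (simp_all add: up_part_def F_op_def scaleR_ell2.rep_eq plus_ell2.rep_eq
        arrow_of_def s)
qed

lemma cinner_ket_up_part:
  "cinner (ket j \<mu> n s) (up_part x) = (if s = Up then cinner (ket j \<mu> n s) x else 0)"
  by (simp add: cinner_ket coord_up_part arrow_of_Abs)

lemma up_part_ket: "up_part (ket j \<mu> n s) = (if s = Up then ket j \<mu> n s else 0)"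
  by (auto intro!: ell2_eqI simp: coord_up_part ket_def coord_ell2_unit zero_ell2.rep_eq arrow_of_Abs)

lemma up_part_idem: "up_part (up_part x) = up_part x"
  by (rule ell2_eqI) (simp add: coord_up_part)

lemma cinner_up_part: "cinner (up_part x) y = cinner x (up_part y)"
  unfolding cinner_ell2_def by (rule infsum_cong) (simp add: coord_up_part)

lemma norm_up_part_le: "norm (up_part x) \<le> norm x"
proof (rule power2_le_imp_le)
  show "(norm (up_part x))\<^sup>2 \<le> (norm x)\<^sup>2"
    unfolding norm_ell2_sq
    by (rule infsum_mono) (auto simp: coord_up_part intro: coord_summable[of "up_part x", unfolded coord_up_part] coord_summable)
qed simp

lemma bounded_clinear_up_part: "bounded_clinear up_part"
  unfolding bounded_clinear_def
proof
  show "bounded_linear up_part"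
  proof (rule bounded_linear_intro[where K = 1])
    show "up_part (x + y) = up_part x + up_part y" for x y
      by (rule ell2_eqI) (simp add: coord_up_part plus_ell2.rep_eq)
    show "up_part (r *\<^sub>R x) = r *\<^sub>R up_part x" for r x
      by (rule ell2_eqI) (simp add: coord_up_part scaleR_ell2.rep_eq)
  qed (simp add: norm_up_part_le)
  show "\<forall>c x. up_part (c *\<^sub>C x) = c *\<^sub>C up_part x"
    by (intro allI ell2_eqI) (simp add: coord_up_part scaleC_ell2.rep_eq)
qed

lemma orthogonal_projection_E: "orthogonal_projection E_proj"
proof
  have E: "E_proj = (\<lambda>z. (up_part (fst z), up_part (snd z)))"
    by (auto simp: fun_eq_iff E_proj_eq)
  have "bounded_linear up_part" by (rule bounded_clinearD(1)[OF bounded_clinear_up_part])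
  then have "bounded_linear E_proj" unfolding E
    by (intro bounded_linear_Pair)
      (auto intro: bounded_linear_compose[of up_part] bounded_linear_fst bounded_linear_snd)
  then show "bounded_clinear E_proj"
    by (simp add: bounded_clinear_def E scaleC_prod_def bounded_clinearD[OF bounded_clinear_up_part])
  show "E_proj (E_proj z) = E_proj z" for z by (simp add: E up_part_idem)
  show "cinner (E_proj z) w = cinner z (E_proj w)" for z w
    by (simp add: E cinner_prod_def cinner_up_part)
qed

lemma norm_E_proj_compl:
  "(norm (z - E_proj z))\<^sup>2
    = (norm (fst z - up_part (fst z)))\<^sup>2 + (norm (snd z - up_part (snd z)))\<^sup>2"
  by (cases z) (simp add: E_proj_eq norm_prod_def)

text \<open>Since \<open>ket\<close> vanishes off the labels, sums over labels can be written as sums over all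
  real triples, where shifts of the quantum numbers are bijections.\<close>

lemma has_sum_ket:
  assumes y: "\<And>l. coord y l = (if arrow_of l = s then coord x l else 0)"
  shows "((\<lambda>(j, \<mu>, n). (cmod (cinner (ket j \<mu> n s) x))\<^sup>2) has_sum (norm y)\<^sup>2) UNIV"
proof -
  let ?f = "\<lambda>l. (cmod (coord x l))\<^sup>2"
  let ?h = "\<lambda>(j, \<mu>, n). Abs_label (j, \<mu>, n, s)"
  let ?L = "{(j, \<mu>, n). is_label j \<mu> n s}"
  have "((\<lambda>l. (cmod (coord y l))\<^sup>2) has_sum (norm y)\<^sup>2) UNIV"
    unfolding norm_ell2_sq by (intro has_sum_infsum coord_summable)
  then have "(?f has_sum (norm y)\<^sup>2) {l. arrow_of l = s}"
    by (rule has_sum_cong_neutral[THEN iffD1, rotated -1]) (auto simp: y)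
  moreover have "bij_betw ?h ?L {l. arrow_of l = s}"
  proof (rule bij_betw_imageI)
    show "inj_on ?h ?L" by (auto simp: inj_on_def Abs_label_inject)
    show "?h ` ?L = {l. arrow_of l = s}"
    proof (intro equalityI subsetI)
      fix l assume l: "l \<in> {l. arrow_of l = s}"
      obtain j \<mu> n s' where "is_label j \<mu> n s'" "l = Abs_label (j, \<mu>, n, s')" by (rule label_cases)
      with l have "(j, \<mu>, n) \<in> ?L" "l = ?h (j, \<mu>, n)" by (auto simp: arrow_of_Abs)
      then show "l \<in> ?h ` ?L" by blast
    qed (auto simp: arrow_of_Abs)
  qed
  ultimately have "((\<lambda>t. ?f (?h t)) has_sum (norm y)\<^sup>2) ?L"
    by (simp add: has_sum_reindex_bij_betw[of ?h _ _ ?f])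
  then show ?thesis
    by (rule has_sum_cong_neutral[THEN iffD1, rotated -1]) (auto simp: cinner_ket)
qed

text \<open>The free offsets a, b, c serve to place all members of one block at the same summation
  index.\<close>

lemma has_sum_ket_up:
  assumes "up_part x = x"
  shows "((\<lambda>(j, \<mu>, n). (cmod (cinner (ket (j + a) (\<mu> + b) (n + c) Up) x))\<^sup>2) has_sum (norm x)\<^sup>2) UNIV"
proof -
  have "((\<lambda>(j, \<mu>, n). (cmod (cinner (ket j \<mu> n Up) x))\<^sup>2) has_sum (norm x)\<^sup>2) UNIV"
    by (rule has_sum_ket) (metis assms coord_up_part)
  moreover have "bij_betw (\<lambda>t. t + (a, b, c)) UNIV UNIV" by (rule bij_plus_right)
  ultimately have "((\<lambda>t. case t + (a, b, c) of (j, \<mu>, n) \<Rightarrow> (cmod (cinner (ket j \<mu> n Up) x))\<^sup>2)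
      has_sum (norm x)\<^sup>2) UNIV"
    by (subst has_sum_reindex_bij_betw)
  then show ?thesis by (simp add: case_prod_beta')
qed

lemma has_sum_ket_down:
  "((\<lambda>(j, \<mu>, n). (cmod (cinner (ket (j + a) (\<mu> + b) (n + c) Down) x))\<^sup>2)
    has_sum (norm (x - up_part x))\<^sup>2) UNIV"
proof -
  have "coord (x - up_part x) l = (if arrow_of l = Down then coord x l else 0)" for l
    by (cases "arrow_of l") (simp_all add: minus_ell2.rep_eq coord_up_part)
  then have "((\<lambda>(j, \<mu>, n). (cmod (cinner (ket j \<mu> n Down) x))\<^sup>2) has_sum (norm (x - up_part x))\<^sup>2) UNIV"
    by (rule has_sum_ket)
  moreover have "bij_betw (\<lambda>t. t + (a, b, c)) UNIV UNIV" by (rule bij_plus_right)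
  ultimately have "((\<lambda>t. case t + (a, b, c) of (j, \<mu>, n) \<Rightarrow> (cmod (cinner (ket j \<mu> n Down) x))\<^sup>2)
      has_sum (norm (x - up_part x))\<^sup>2) UNIV"
    by (subst has_sum_reindex_bij_betw)
  then show ?thesis by (simp add: case_prod_beta')
qed

section \<open>q-numbers\<close>

text \<open>The mixed terms q powr (a - b) cancel. Splitting 2j+1 or 2j+2 by this rule is what
  evaluates the block norms.\<close>

lemma qnum_add:
  assumes "0 < q"
  shows "qnum q (a + b) = q powr (-b) * qnum q a + q powr a * qnum q b"
proof -
  have "q powr (-b) * (q powr (-a) - q powr a) + q powr a * (q powr (-b) - q powr b)
      = q powr (-(a + b)) - q powr (a + b)"
    by (simp add: algebra_simps flip: powr_add)
  then show ?thesis unfolding qnum_def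
    by (metis add_divide_distrib times_divide_eq_right)
qed

lemma qnum_mono:
  assumes "0 < q" "q < 1" "a \<le> b" shows "qnum q a \<le> qnum q b"
proof -
  have "inverse q - q > 0" using assms one_less_inverse[of q] by simp
  moreover have "q powr b \<le> q powr a" "q powr (-a) \<le> q powr (-b)"
    using assms by (simp_all add: powr_mono')
  ultimately show ?thesis unfolding qnum_def by (intro divide_right_mono) auto
qed

lemma qnum_zero [simp]: "qnum q 0 = 0"
  by (simp add: qnum_def)

lemma qnum_nonneg: "0 < q \<Longrightarrow> q < 1 \<Longrightarrow> 0 \<le> k \<Longrightarrow> 0 \<le> qnum q k"
  using qnum_mono[of q 0 k] by simp

lemma qnum_one: "0 < q \<Longrightarrow> q < 1 \<Longrightarrow> qnum q 1 = 1"
proof -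
  assume q: "0 < q" "q < 1"
  then have "inverse q - q \<noteq> 0" using one_less_inverse[of q] by simp
  with q show ?thesis by (simp add: qnum_def powr_minus)
qed

lemma qnum_two: "0 < q \<Longrightarrow> q < 1 \<Longrightarrow> qnum q 2 = q + inverse q"
  using qnum_add[of q 1 1] by (simp add: qnum_one powr_minus)

lemma qnum_ge_one: "0 < q \<Longrightarrow> q < 1 \<Longrightarrow> 1 \<le> k \<Longrightarrow> 1 \<le> qnum q k"
  using qnum_mono[of q 1 k] by (simp add: qnum_one)

text \<open>By monotonicity it suffices to treat k = 2, where q + 1/q exceeds 2 by (1 - q)^2 /
  q.\<close>

lemma qnum_ge_two:
  assumes "0 < q" "q < 1" "2 \<le> k" shows "2 \<le> qnum q k"
proof -
  have "0 \<le> (1 - q)\<^sup>2 / q" using assms by simp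
  also have "(1 - q)\<^sup>2 / q = q + inverse q - 2"
    using assms by (simp add: field_simps power2_eq_square)
  finally show ?thesis using qnum_mono[of q 2 k] assms by (simp add: qnum_two)
qed

section \<open>Powers of q and rank-one estimates\<close>

lemma powr_square: "(x powr a)\<^sup>2 = x powr (2 * a)" for x a :: real
  by (simp add: power2_eq_square flip: powr_add)

lemma cmod_lincomb_sq_le:
  "(cmod (of_real a * X - of_real b * Y))\<^sup>2 \<le> (a\<^sup>2 + b\<^sup>2) * ((cmod X)\<^sup>2 + (cmod Y)\<^sup>2)"
proof -
  have "cmod (of_real a * X - of_real b * Y) \<le> \<bar>a\<bar> * cmod X + \<bar>b\<bar> * cmod Y"
    using norm_triangle_ineq4[of "of_real a * X" "of_real b * Y"] by (simp add: norm_mult)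
  then have "(cmod (of_real a * X - of_real b * Y))\<^sup>2 \<le> (\<bar>a\<bar> * cmod X + \<bar>b\<bar> * cmod Y)\<^sup>2"
    by (intro power_mono) auto
  \<comment> \<open>The added square completes the expression to a product of two sums of squares,
    by Lagrange's identity.\<close>
  also have "\<dots> \<le> (\<bar>a\<bar> * cmod X + \<bar>b\<bar> * cmod Y)\<^sup>2 + (\<bar>a\<bar> * cmod Y - \<bar>b\<bar> * cmod X)\<^sup>2" by simp
  also have "\<dots> = (\<bar>a\<bar>\<^sup>2 + \<bar>b\<bar>\<^sup>2) * ((cmod X)\<^sup>2 + (cmod Y)\<^sup>2)"
    by (simp only: power2_eq_square algebra_simps)
  finally show ?thesis by simp
qed

lemma powr_mult_eq: "a + b = c \<Longrightarrow> x powr a * x powr b = x powr c" for x :: real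
  by (simp flip: powr_add)

lemma real_lincomb_factor:
  fixes X Y :: complex and \<alpha> \<beta> e a b :: real
  assumes "z = of_real \<alpha> * X + of_real \<beta> * Y" "\<alpha> = e * a" "\<beta> = - (e * b)"
  shows "z = of_real e * (of_real a * X - of_real b * Y)"
  unfolding assms by (simp add: algebra_simps)

text \<open>A block with column (e1, e2) and row (a, -b) has squared norm (e1^2 + e2^2)(a^2 + b^2).
  Inequalities for g1 and g2 leave room for targets that are not labels.\<close>

lemma rank_one_block_bound:
  fixes g1 g2 :: real
  assumes "g1 \<le> (e1 * cmod R)\<^sup>2" "g2 \<le> (e2 * cmod R)\<^sup>2"
    and "R = of_real a * X - of_real b * Y"
    and "(e1\<^sup>2 + e2\<^sup>2) * (a\<^sup>2 + b\<^sup>2) = C"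
  shows "g1 + g2 \<le> C * ((cmod X)\<^sup>2 + (cmod Y)\<^sup>2)"
proof -
  have "g1 + g2 \<le> (e1\<^sup>2 + e2\<^sup>2) * (cmod R)\<^sup>2"
    using assms(1,2) by (simp add: power_mult_distrib algebra_simps)
  also have "\<dots> \<le> (e1\<^sup>2 + e2\<^sup>2) * ((a\<^sup>2 + b\<^sup>2) * ((cmod X)\<^sup>2 + (cmod Y)\<^sup>2))"
    unfolding assms(3) by (intro mult_left_mono cmod_lincomb_sq_le) simp
  finally show ?thesis by (simp add: mult.assoc flip: assms(4))
qed

section \<open>The representation\<close>

locale suq2_pi' =
  fixes q :: real and pi' :: "suq2_elem \<Rightarrow> hspace \<Rightarrow> hspace"
  assumes q: "0 < q" "q < 1" and pi': "is_pi' q pi'"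
begin

abbreviation rep :: "suq2_expr \<Rightarrow> hspace \<Rightarrow> hspace" where "rep x \<equiv> pi' (suq2_class q x)"
abbreviation "A \<equiv> rep GenA"
abbreviation "As \<equiv> rep (Star GenA)"
abbreviation "B \<equiv> rep GenB"
abbreviation "Bs \<equiv> rep (Star GenB)"

lemma star_rep: "suq2_star_rep q pi'"
  using pi' by (simp add: is_pi'_def)

lemma rep_bounded: "bounded_clinear (rep x)"
  and rep_One: "rep One = id"
  and rep_Add: "rep (Add x y) v = rep x v + rep y v"
  and rep_Mul: "rep (Mul x y) v = rep x (rep y v)"
  and rep_Scale: "rep (Scale c x) v = c *\<^sub>C rep x v"
  and rep_adj: "cinner (rep x v) w = cinner v (rep (Star x) w)"
  using star_rep by (simp_all add: suq2_star_rep_def)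

lemma rep_adj': "cinner (rep (Star x) v) w = cinner v (rep x w)"
  by (metis cinner_commute rep_adj)

lemma rep_linear: "rep x (v + w) = rep x v + rep x w" "rep x (r *\<^sub>R v) = r *\<^sub>R rep x v"
  using bounded_clinearD[OF rep_bounded] by blast+

lemma rep_eq: "suq2_eq q x y \<Longrightarrow> rep x = rep y"
  unfolding suq2_class_def
  by (intro arg_cong[where f = pi'] Collect_cong) (blast intro: eq_sym eq_trans)

lemma relations:
  "B (A v) = q *\<^sub>R A (B v)"
  "B (Bs v) = Bs (B v)"
  "Bs (A v) = q *\<^sub>R A (Bs v)"
  "A (As v) + B (Bs v) = v"
  "As (A v) + q\<^sup>2 *\<^sub>R B (Bs v) = v"
  using rep_eq[OF rel_ba] rep_eq[OF rel_normal] rep_eq[OF rel_bstar_a] rep_eq[OF rel_sphere1]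
    rep_eq[OF rel_sphere2]
  by (simp_all add: fun_eq_iff rep_Add rep_Mul rep_Scale rep_One scaleC_of_real
      flip: of_real_power)

text \<open>The adjoints of the first and the third relation.\<close>

lemma relations_star:
  "As (Bs v) = q *\<^sub>R Bs (As v)"
  "As (B v) = q *\<^sub>R B (As v)"
  by (rule cinner_extensionality, metis relations(1,3) rep_adj rep_adj' cinner_scaleR_left
      cinner_scaleR_right)+

section \<open>The unitary \<open>V\<close> and its inverse \<open>W\<close>\<close>

definition V where "V = mat2_op pi' (V_mat q)"

text \<open>The conjugate transpose of the matrix of \<open>V\<close>. Its off-diagonal part
  controls the cokernel.\<close>

definition W where "W = (\<lambda>(x, y). ((-q) *\<^sub>R B x + As y, A x + Bs y))"

lemma V_eq: "V (x, y) = ((-q) *\<^sub>R Bs x + As y, A x + B y)"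
proof -
  have "rep (Scale (of_real (-q)) (Star GenB)) x = (-q) *\<^sub>R Bs x"
    unfolding rep_Scale by (rule scaleC_of_real)
  then show ?thesis by (simp add: V_def V_mat_def)
qed

lemma W_eq: "W (x, y) = ((-q) *\<^sub>R B x + As y, A x + Bs y)"
  by (simp add: W_def)

lemma V_adj: "cinner (V z) w = cinner z (W w)"
  by (cases z; cases w) (simp add: V_eq W_eq cinner_prod_def cinner_add_left cinner_add_right
      cinner_scaleR_left cinner_scaleR_right rep_adj[of GenA] rep_adj[of GenB] rep_adj'
      algebra_simps del: scaleR_minus_left)

lemma mat2_bounded_clinear:
  "bounded_clinear (\<lambda>z. (r *\<^sub>R rep a (fst z) + rep b (snd z), rep c (fst z) + rep d (snd z)))"
proof -
  have "bounded_linear (\<lambda>z. rep x (fst z))" "bounded_linear (\<lambda>z. rep x (snd z))" for x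
    by (intro bounded_linear_compose[OF bounded_clinearD(1)[OF rep_bounded]]
        bounded_linear_fst bounded_linear_snd)+
  then have "bounded_linear
      (\<lambda>z. (r *\<^sub>R rep a (fst z) + rep b (snd z), rep c (fst z) + rep d (snd z)))"
    by (intro bounded_linear_Pair bounded_linear_add
        bounded_linear_compose[OF bounded_linear_scaleR_right[of r]])
  then show ?thesis
    by (simp add: bounded_clinear_def scaleC_prod_def bounded_clinearD(2)[OF rep_bounded]
        scaleC_add_right scaleR_eq_scaleC scaleC_scaleC mult.commute)
qed

lemma bounded_V: "bounded_clinear V" and bounded_W: "bounded_clinear W"
proof -
  have "V = (\<lambda>z. ((-q) *\<^sub>R Bs (fst z) + As (snd z), A (fst z) + B (snd z)))"
    and "W = (\<lambda>z. ((-q) *\<^sub>R B (fst z) + As (snd z), A (fst z) + Bs (snd z)))"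
    by (auto simp: fun_eq_iff V_eq W_eq)
  then show "bounded_clinear V" "bounded_clinear W" by (simp_all only: mat2_bounded_clinear)
qed

text \<open>The cross terms cancel by the q-commutation relations between a and b; the diagonal
  terms are the two sphere relations.\<close>

lemma W_V: "W (V z) = z"
proof (cases z)
  case (Pair x y)
  have "(-q) *\<^sub>R B ((-q) *\<^sub>R Bs x + As y) + As (A x + B y) = As (A x) + q\<^sup>2 *\<^sub>R B (Bs x)"
    unfolding rep_linear relations_star by (simp add: algebra_simps power2_eq_square)
  moreover have "A ((-q) *\<^sub>R Bs x + As y) + Bs (A x + B y) = A (As y) + B (Bs y)"
    unfolding rep_linear relations(2,3) by (simp add: algebra_simps)
  ultimately show ?thesis unfolding Pair V_eq W_eq by (simp only: relations(4,5))
qed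

lemma V_W: "V (W z) = z"
proof (cases z)
  case (Pair x y)
  have "(-q) *\<^sub>R Bs ((-q) *\<^sub>R B x + As y) + As (A x + Bs y) = As (A x) + q\<^sup>2 *\<^sub>R B (Bs x)"
    unfolding rep_linear relations_star relations(2) by (simp add: algebra_simps power2_eq_square)
  moreover have "A ((-q) *\<^sub>R B x + As y) + B (A x + Bs y) = A (As y) + B (Bs y)"
    unfolding rep_linear relations(1) by (simp add: algebra_simps)
  ultimately show ?thesis unfolding Pair V_eq W_eq by (simp only: relations(4,5))
qed

section \<open>Compatibility with the modular operator\<close>

lemma A_ket_Up:
  "is_label j \<mu> n Up \<Longrightarrow> A (ket j \<mu> n Up) =
      mat2_entry (alpha_plus q j \<mu> n) Up Up *\<^sub>R ket (j + 1/2) (\<mu> + 1/2) (n + 1/2) Up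
    + mat2_entry (alpha_plus q j \<mu> n) Down Up *\<^sub>R ket (j + 1/2) (\<mu> + 1/2) (n + 1/2) Down
    + mat2_entry (alpha_minus q j \<mu> n) Up Up *\<^sub>R ket (j - 1/2) (\<mu> + 1/2) (n + 1/2) Up"
  and B_ket_Up:
  "is_label j \<mu> n Up \<Longrightarrow> B (ket j \<mu> n Up) =
      mat2_entry (beta_plus q j \<mu> n) Up Up *\<^sub>R ket (j + 1/2) (\<mu> + 1/2) (n - 1/2) Up
    + mat2_entry (beta_plus q j \<mu> n) Down Up *\<^sub>R ket (j + 1/2) (\<mu> + 1/2) (n - 1/2) Down
    + mat2_entry (beta_minus q j \<mu> n) Up Up *\<^sub>R ket (j - 1/2) (\<mu> + 1/2) (n - 1/2) Up"
  and A_ket_Down: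
  "is_label j \<mu> n Down \<Longrightarrow> A (ket j \<mu> n Down) =
      mat2_entry (alpha_plus q j \<mu> n) Down Down *\<^sub>R ket (j + 1/2) (\<mu> + 1/2) (n + 1/2) Down
    + mat2_entry (alpha_minus q j \<mu> n) Down Down *\<^sub>R ket (j - 1/2) (\<mu> + 1/2) (n + 1/2) Down
    + mat2_entry (alpha_minus q j \<mu> n) Up Down *\<^sub>R ket (j - 1/2) (\<mu> + 1/2) (n + 1/2) Up"
  and B_ket_Down:
  "is_label j \<mu> n Down \<Longrightarrow> B (ket j \<mu> n Down) =
      mat2_entry (beta_plus q j \<mu> n) Down Down *\<^sub>R ket (j + 1/2) (\<mu> + 1/2) (n - 1/2) Down
    + mat2_entry (beta_minus q j \<mu> n) Down Down *\<^sub>R ket (j - 1/2) (\<mu> + 1/2) (n - 1/2) Down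
    + mat2_entry (beta_minus q j \<mu> n) Up Down *\<^sub>R ket (j - 1/2) (\<mu> + 1/2) (n - 1/2) Up"
  using pi' by (simp_all add: is_pi'_def)

text \<open>a raises \<mu> and n by 1/2 each, hence \<mu> + n by 1.\<close>

lemma A_K_shift:
  assumes "coord (A (ell2_unit k)) l \<noteq> 0"
  shows "K_weight q l = q powr (-2) * K_weight q k"
proof -
  obtain j \<mu> n s where k: "is_label j \<mu> n s" "k = Abs_label (j, \<mu>, n, s)" by (rule label_cases)
  obtain j' \<mu>' n' s' where l: "is_label j' \<mu>' n' s'" "l = Abs_label (j', \<mu>', n', s')"
    by (rule label_cases)
  have "cinner (ket j' \<mu>' n' s') (A (ket j \<mu> n s)) \<noteq> 0"
    using assms k l by (simp add: cinner_ket) (simp add: ket_def)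
  then have "\<mu>' = \<mu> + 1/2 \<and> n' = n + 1/2"
    using k(1) by (cases s) (auto simp: A_ket_Up A_ket_Down cinner_add_right cinner_scaleR_right
        cinner_ket_ket split: if_splits)
  then show ?thesis using k l by (simp add: K_weight_Abs algebra_simps flip: powr_add)
qed

text \<open>b raises \<mu> and lowers n by 1/2, which keeps \<mu> + n. The factor 1 matches the
  shape expected by \<open>diag_op_weight_shift\<close>.\<close>

lemma B_K_shift:
  assumes "coord (B (ell2_unit k)) l \<noteq> 0"
  shows "K_weight q l = 1 * K_weight q k"
proof -
  obtain j \<mu> n s where k: "is_label j \<mu> n s" "k = Abs_label (j, \<mu>, n, s)" by (rule label_cases)
  obtain j' \<mu>' n' s' where l: "is_label j' \<mu>' n' s'" "l = Abs_label (j', \<mu>', n', s')"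
    by (rule label_cases)
  have "cinner (ket j' \<mu>' n' s') (B (ket j \<mu> n s)) \<noteq> 0"
    using assms k l by (simp add: cinner_ket) (simp add: ket_def)
  then have "\<mu>' = \<mu> + 1/2 \<and> n' = n - 1/2"
    using k(1) by (cases s) (auto simp: B_ket_Up B_ket_Down cinner_add_right cinner_scaleR_right
        cinner_ket_ket split: if_splits)
  then show ?thesis using k l by (simp add: K_weight_Abs)
qed

lemma coord_rep_Star: "coord (rep (Star x) (ell2_unit k)) l = cnj (coord (rep x (ell2_unit l)) k)"
  by (metis cinner_commute cinner_ell2_unit rep_adj)

lemma As_K_shift:
  assumes "coord (As (ell2_unit k)) l \<noteq> 0"
  shows "K_weight q l = q powr 2 * K_weight q k"
proof -
  have "K_weight q k = q powr (-2) * K_weight q l"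
    by (rule A_K_shift) (use assms in \<open>simp add: coord_rep_Star\<close>)
  moreover have "q powr 2 * (q powr (-2) * K_weight q l) = K_weight q l"
    using q by (simp only: mult.assoc[symmetric] powr_add[symmetric]) simp
  ultimately show ?thesis by simp
qed

lemma Bs_K_shift:
  assumes "coord (Bs (ell2_unit k)) l \<noteq> 0"
  shows "K_weight q l = 1 * K_weight q k"
  using B_K_shift[of l k] assms by (simp add: coord_rep_Star)

lemmas A_K = diag_op_weight_shift[where A = A, OF rep_adj A_K_shift]
lemmas B_K = diag_op_weight_shift[where A = B, OF rep_adj B_K_shift]
lemmas As_K = diag_op_weight_shift[where A = As, OF rep_adj' As_K_shift]
lemmas Bs_K = diag_op_weight_shift[where A = Bs, OF rep_adj' Bs_K_shift]

text \<open>Moving K past \<open>A\<close> costs q powr (-2) and past \<open>As\<close> costs q powr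
  2. \<open>A\<close> leads from the first component to the second and \<open>As\<close> back, and
  the factors 1/q and q in \<open>Ktilde\<close> compensate exactly this. \<open>B\<close> and
  \<open>Bs\<close> stay within a component and keep the weight.\<close>

lemma V_commutes_Ktilde: "commutes_with_unbounded V (Ktilde_dom q) (Ktilde q)"
  unfolding commutes_with_unbounded_def
proof (intro conjI ballI equalityI subsetI)
  fix w assume "w \<in> V ` Ktilde_dom q"
  then obtain x y where "x \<in> K_dom q" "y \<in> K_dom q" "w = V (x, y)" by (auto simp: Ktilde_dom_def)
  then show "w \<in> Ktilde_dom q"
    by (simp add: V_eq Ktilde_dom_def diag_dom_add diag_dom_scaleR A_K B_K As_K Bs_K
        del: scaleR_minus_left)
next
  fix w assume "w \<in> Ktilde_dom q"
  \<comment> \<open>The image under \<open>V\<close> is the full domain because the inverse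
    \<open>W\<close> preserves the domain as well.\<close>
  then have "W w \<in> Ktilde_dom q"
    by (cases w) (simp add: W_eq Ktilde_dom_def diag_dom_add diag_dom_scaleR A_K B_K As_K Bs_K
        del: scaleR_minus_left)
  then show "w \<in> V ` Ktilde_dom q" using V_W[of w] by (metis imageI)
next
  fix w assume "w \<in> Ktilde_dom q"
  then obtain x y where w: "w = (x, y)" and xy: "x \<in> K_dom q" "y \<in> K_dom q"
    by (auto simp: Ktilde_dom_def)
  have q2: "q powr 2 = q * q" "q powr (-2) = inverse q * inverse q"
    using q by (simp_all add: powr_minus power2_eq_square)
  show "V (Ktilde q w) = Ktilde q (V w)"
    using q xy unfolding w
    by (simp add: V_eq Ktilde_def diag_op_add diag_dom_add diag_dom_scaleR diag_op_scaleR
        A_K B_K As_K Bs_K rep_linear q2 scaleR_add_right mult.assoc[symmetric]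
        del: scaleR_minus_left)
qed

section \<open>Matrix coefficients from up to down vectors\<close>

text \<open>The action of \<open>A\<close> is known on basis vectors only, so the coefficient is
  found on the adjoint side: an up vector whose image under \<open>A\<close> meets the given down
  vector must have the quantum numbers j, \<mu>, n. If these do not form a label, both sides are
  0.\<close>

lemma cinner_ket_Down_A:
  assumes x: "up_part x = x"
    and l: "is_label (j + 1/2) (\<mu> + 1/2) (n + 1/2) Down"
  shows "cinner (ket (j + 1/2) (\<mu> + 1/2) (n + 1/2) Down) (A x)
    = of_real (mat2_entry (alpha_plus q j \<mu> n) Down Up) * cinner (ket j \<mu> n Up) x"
proof -
  let ?k = "ket (j + 1/2) (\<mu> + 1/2) (n + 1/2) Down"
  have "up_part (As ?k) = mat2_entry (alpha_plus q j \<mu> n) Down Up *\<^sub>R ket j \<mu> n Up"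
  proof (rule ell2_eqI)
    fix k
    obtain j' \<mu>' n' s where k: "is_label j' \<mu>' n' s" "k = Abs_label (j', \<mu>', n', s)"
      by (rule label_cases)
    have "cinner (ket j' \<mu>' n' s) (up_part (As ?k))
        = cinner (ket j' \<mu>' n' s) (mat2_entry (alpha_plus q j \<mu> n) Down Up *\<^sub>R ket j \<mu> n Up)"
    proof (cases s)
      case Up
      have "cinner (ket j' \<mu>' n' s) (up_part (As ?k)) = cinner (A (ket j' \<mu>' n' Up)) ?k"
        by (simp add: cinner_ket_up_part Up rep_adj)
      then show ?thesis
        using k(1) l by (auto simp: Up A_ket_Up cinner_add_left cinner_scaleR_left
            cinner_scaleR_right cinner_ket_ket)
    qed (simp add: cinner_ket_up_part cinner_scaleR_right cinner_ket_ket)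
    then show "coord (up_part (As ?k)) k =
        coord (mat2_entry (alpha_plus q j \<mu> n) Down Up *\<^sub>R ket j \<mu> n Up) k"
      using k by (simp add: cinner_ket)
  qed
  then show ?thesis by (metis x rep_adj' cinner_up_part cinner_scaleR_left)
qed

lemma cinner_ket_Down_B:
  assumes x: "up_part x = x"
    and l: "is_label (j + 1/2) (\<mu> + 1/2) (n - 1/2) Down"
  shows "cinner (ket (j + 1/2) (\<mu> + 1/2) (n - 1/2) Down) (B x)
    = of_real (mat2_entry (beta_plus q j \<mu> n) Down Up) * cinner (ket j \<mu> n Up) x"
proof -
  let ?k = "ket (j + 1/2) (\<mu> + 1/2) (n - 1/2) Down"
  have "up_part (Bs ?k) = mat2_entry (beta_plus q j \<mu> n) Down Up *\<^sub>R ket j \<mu> n Up"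
  proof (rule ell2_eqI)
    fix k
    obtain j' \<mu>' n' s where k: "is_label j' \<mu>' n' s" "k = Abs_label (j', \<mu>', n', s)"
      by (rule label_cases)
    have "cinner (ket j' \<mu>' n' s) (up_part (Bs ?k))
        = cinner (ket j' \<mu>' n' s) (mat2_entry (beta_plus q j \<mu> n) Down Up *\<^sub>R ket j \<mu> n Up)"
    proof (cases s)
      case Up
      have "cinner (ket j' \<mu>' n' s) (up_part (Bs ?k)) = cinner (B (ket j' \<mu>' n' Up)) ?k"
        by (simp add: cinner_ket_up_part Up rep_adj)
      then show ?thesis
        using k(1) l by (auto simp: Up B_ket_Up cinner_add_left cinner_scaleR_left
            cinner_scaleR_right cinner_ket_ket)
    qed (simp add: cinner_ket_up_part cinner_scaleR_right cinner_ket_ket)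
    then show "coord (up_part (Bs ?k)) k =
        coord (mat2_entry (beta_plus q j \<mu> n) Down Up *\<^sub>R ket j \<mu> n Up) k"
      using k by (simp add: cinner_ket)
  qed
  then show ?thesis by (metis x rep_adj' cinner_up_part cinner_scaleR_left)
qed

lemma cinner_ket_Down_of_up: "up_part x = x \<Longrightarrow> cinner (ket j \<mu> n Down) x = 0"
  by (metis cinner_ket_up_part arrow.distinct(1))

text \<open>Moved to the other side, \<open>As\<close> becomes \<open>A\<close> on a down vector.
  Two of the resulting three terms are down vectors and hence orthogonal to x.\<close>

lemma cinner_ket_Down_As:
  assumes "up_part x = x" "is_label j \<mu> n Down"
  shows "cinner (ket j \<mu> n Down) (As x)
    = of_real (mat2_entry (alpha_minus q j \<mu> n) Up Down)
      * cinner (ket (j - 1/2) (\<mu> + 1/2) (n + 1/2) Up) x"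
  using assms by (simp add: A_ket_Down cinner_add_left cinner_scaleR_left cinner_ket_Down_of_up
      flip: rep_adj)

lemma cinner_ket_Down_Bs:
  assumes "up_part x = x" "is_label j \<mu> n Down"
  shows "cinner (ket j \<mu> n Down) (Bs x)
    = of_real (mat2_entry (beta_minus q j \<mu> n) Up Down)
      * cinner (ket (j - 1/2) (\<mu> + 1/2) (n - 1/2) Up) x"
  using assms by (simp add: B_ket_Down cinner_add_left cinner_scaleR_left cinner_ket_Down_of_up
      flip: rep_adj)

section \<open>Rank-one factorization of the blocks\<close>

lemma sqrt_qnum_sq: "0 \<le> k \<Longrightarrow> (sqrt (qnum q k))\<^sup>2 = qnum q k"
  using q by (simp add: qnum_nonneg)

text \<open>The factor shared by all coefficients of a block, in terms of the quantum numbers of the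
  source in the first component. Lowering coefficients are taken at j + 1/2, which turns their
  denominators [2j][2j+1] into [2j+1][2j+2].\<close>

definition coeff :: "real \<Rightarrow> real \<Rightarrow> real \<Rightarrow> real" where
  "coeff j \<mu> n = q powr ((\<mu> + n - 1/2) / 2) / (qnum q (2*j + 1) * qnum q (2*j + 2))"

lemma coeff_sq:
  "(coeff j \<mu> n)\<^sup>2 = q powr (\<mu> + n - 1/2) / ((qnum q (2*j + 1))\<^sup>2 * (qnum q (2*j + 2))\<^sup>2)"
proof -
  have "(q powr ((\<mu> + n - 1/2) / 2))\<^sup>2 = q powr (\<mu> + n - 1/2)"
    unfolding powr_square by (rule arg_cong[where f = "(powr) q"]) simp
  then show ?thesis by (simp only: coeff_def power_divide power_mult_distrib)
qed

text \<open>The linear forms through which the rank-one blocks of \<open>V\<close> and \<open>W\<close> factor.\<close>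

definition form_V :: "real \<Rightarrow> real \<Rightarrow> complex \<Rightarrow> complex \<Rightarrow> complex" where
  "form_V j n X Y = of_real (q powr (1/2) * sqrt (qnum q (j - n + 1/2))) * X
     - of_real (q powr (-j - 1/2) * sqrt (qnum q (j + n + 3/2))) * Y"

definition form_W :: "real \<Rightarrow> real \<Rightarrow> complex \<Rightarrow> complex \<Rightarrow> complex" where
  "form_W j \<mu> X Y = of_real (q powr (-j) * sqrt (qnum q (j + \<mu> + 1))) * X
     - of_real (q powr (1/2) * sqrt (qnum q (j - \<mu>))) * Y"

text \<open>Apart from \<open>coeff\<close>, each of the four coefficients is a factor in \<mu>
  attached to the target times a factor in n attached to the source. Both target components are
  therefore multiples of one linear form, which makes the block rank one.\<close>

lemma down_V:
  fixes j \<mu> n :: real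
  assumes x: "up_part x = x" and y: "up_part y = y"
  defines "X \<equiv> cinner (ket j \<mu> n Up) x" and "Y \<equiv> cinner (ket j \<mu> (n + 1) Up) y"
  shows "is_label (j + 1/2) (\<mu> - 1/2) (n + 1/2) Down \<Longrightarrow>
      cinner (ket (j + 1/2) (\<mu> - 1/2) (n + 1/2) Down) (fst (V (x, y)))
      = of_real (coeff j \<mu> n * sqrt (qnum q (j - \<mu> + 1)) * q powr (j + 1)) * form_V j n X Y"
    and "is_label (j + 1/2) (\<mu> + 1/2) (n + 1/2) Down \<Longrightarrow>
      cinner (ket (j + 1/2) (\<mu> + 1/2) (n + 1/2) Down) (snd (V (x, y)))
      = of_real (coeff j \<mu> n * sqrt (qnum q (j + \<mu> + 1))) * form_V j n X Y"
proof -
  let ?N = "qnum q (2*j + 1) * qnum q (2*j + 2)"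
  have shift: "q powr ((\<mu> + n + 1/2) / 2) = q powr ((\<mu> + n - 1/2) / 2) * q powr (1/2)"
    by (simp add: field_simps flip: powr_add)
  \<comment> \<open>The leading q comes from the upper left entry of the matrix of
    \<open>V\<close>.\<close>
  have qq: "q * q powr (j + 1/2) = q powr (j + 1) * q powr (1/2)"
    using q by (simp add: powr_add)
  have qj: "q powr (j + 1) * q powr (-j - 1/2) = q powr (1/2)"
    "q powr (-j - 1) * q powr (1/2) = q powr (-j - 1/2)"
    by (simp_all add: algebra_simps flip: powr_add)
  {
    assume l: "is_label (j + 1/2) (\<mu> - 1/2) (n + 1/2) Down"
    let ?a = "mat2_entry (alpha_minus q (j + 1/2) (\<mu> - 1/2) (n + 1/2)) Up Down"
    let ?b = "mat2_entry (beta_minus q (j + 1/2) (\<mu> - 1/2) (n + 1/2)) Up Down"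
    have "cinner (ket (j + 1/2) (\<mu> - 1/2) (n + 1/2) Down) (fst (V (x, y)))
      = of_real (- q * ?b) * X + of_real ?a * Y"
      using cinner_ket_Down_As[OF y l] cinner_ket_Down_Bs[OF x l]
      by (simp add: V_eq cinner_add_right cinner_scaleR_right X_def Y_def add.assoc
          del: scaleR_minus_left)
    moreover have "- q * ?b = coeff j \<mu> n * sqrt (qnum q (j - \<mu> + 1)) * q powr (j + 1)
        * (q powr (1/2) * sqrt (qnum q (j - n + 1/2)))"
    proof -
      have "- q * ?b = (q * q powr (j + 1/2)) * q powr ((\<mu> + n - 1/2) / 2)
          * sqrt (qnum q (j - \<mu> + 1)) * sqrt (qnum q (j - n + 1/2)) / ?N"
        by (simp add: beta_minus_def algebra_simps)
      then show ?thesis unfolding qq by (simp add: coeff_def)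
    qed
    moreover have "?a = - (coeff j \<mu> n * sqrt (qnum q (j - \<mu> + 1)) * q powr (j + 1)
        * (q powr (-j - 1/2) * sqrt (qnum q (j + n + 3/2))))"
    proof -
      have "?a = - (q powr (1/2) * q powr ((\<mu> + n - 1/2) / 2)
          * sqrt (qnum q (j - \<mu> + 1)) * sqrt (qnum q (j + n + 3/2)) / ?N)"
        by (simp add: alpha_minus_def algebra_simps)
      then show ?thesis unfolding qj(1)[symmetric] by (simp add: coeff_def)
    qed
    ultimately show "cinner (ket (j + 1/2) (\<mu> - 1/2) (n + 1/2) Down) (fst (V (x, y)))
      = of_real (coeff j \<mu> n * sqrt (qnum q (j - \<mu> + 1)) * q powr (j + 1)) * form_V j n X Y"
      unfolding form_V_def by (rule real_lincomb_factor)
  }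
  {
    assume l: "is_label (j + 1/2) (\<mu> + 1/2) (n + 1/2) Down"
    let ?a = "mat2_entry (alpha_plus q j \<mu> n) Down Up"
    let ?b = "mat2_entry (beta_plus q j \<mu> (n + 1)) Down Up"
    \<comment> \<open>\<open>B\<close> lowers n while \<open>A\<close> raises it, so sources n + 1
      and n reach the same target n + 1/2.\<close>
    have n: "n + 1 - 1/2 = n + 1/2" by simp
    have "cinner (ket (j + 1/2) (\<mu> + 1/2) (n + 1/2) Down) (snd (V (x, y)))
      = of_real ?a * X + of_real ?b * Y"
      using cinner_ket_Down_A[OF x l] cinner_ket_Down_B[OF y, of j \<mu> "n + 1", unfolded n, OF l]
      by (simp add: V_eq cinner_add_right X_def Y_def)
    moreover have "?a = coeff j \<mu> n * sqrt (qnum q (j + \<mu> + 1))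
        * (q powr (1/2) * sqrt (qnum q (j - n + 1/2)))"
      by (simp add: alpha_plus_def coeff_def)
    moreover have "?b = - (coeff j \<mu> n * sqrt (qnum q (j + \<mu> + 1))
        * (q powr (-j - 1/2) * sqrt (qnum q (j + n + 3/2))))"
    proof -
      have "?b = - (q powr ((\<mu> + n + 1/2) / 2) * q powr (-j - 1)
          * sqrt (qnum q (j + \<mu> + 1)) * sqrt (qnum q (j + n + 3/2)) / ?N)"
        by (simp add: beta_plus_def algebra_simps)
      then show ?thesis unfolding shift qj(2)[symmetric] by (simp add: coeff_def)
    qed
    ultimately show "cinner (ket (j + 1/2) (\<mu> + 1/2) (n + 1/2) Down) (snd (V (x, y)))
      = of_real (coeff j \<mu> n * sqrt (qnum q (j + \<mu> + 1))) * form_V j n X Y"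
      unfolding form_V_def by (rule real_lincomb_factor)
  }
qed

text \<open>As for \<open>V\<close> with the roles of \<mu> and n exchanged: apart from
  \<open>coeff\<close>, the linear form depends on \<mu> and the outer factors on n.\<close>

lemma down_W:
  fixes j \<mu> n :: real
  assumes x: "up_part x = x" and y: "up_part y = y"
  defines "X \<equiv> cinner (ket j \<mu> n Up) x" and "Y \<equiv> cinner (ket j (\<mu> + 1) n Up) y"
  shows "is_label (j + 1/2) (\<mu> + 1/2) (n - 1/2) Down \<Longrightarrow>
      cinner (ket (j + 1/2) (\<mu> + 1/2) (n - 1/2) Down) (fst (W (x, y)))
      = of_real (coeff j \<mu> n * sqrt (qnum q (j + n + 1/2))) * form_W j \<mu> X Y"
    and "is_label (j + 1/2) (\<mu> + 1/2) (n + 1/2) Down \<Longrightarrow>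
      cinner (ket (j + 1/2) (\<mu> + 1/2) (n + 1/2) Down) (snd (W (x, y)))
      = of_real (coeff j \<mu> n * sqrt (qnum q (j - n + 1/2)) * q powr (j + 1/2)) * form_W j \<mu> X Y"
proof -
  let ?N = "qnum q (2*j + 1) * qnum q (2*j + 2)"
  have shift: "q powr ((\<mu> + n + 1/2) / 2) = q powr ((\<mu> + n - 1/2) / 2) * q powr (1/2)"
    by (simp add: field_simps flip: powr_add)
  have qq: "q * q powr (-j - 1) = q powr (-j)"
    using q by (simp add: powr_diff)
  have qj: "q powr (j + 1/2) * q powr (-j) = q powr (1/2)"
    by (simp flip: powr_add)
  {
    assume l: "is_label (j + 1/2) (\<mu> + 1/2) (n - 1/2) Down"
    let ?a = "mat2_entry (alpha_minus q (j + 1/2) (\<mu> + 1/2) (n - 1/2)) Up Down"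
    let ?b = "mat2_entry (beta_plus q j \<mu> n) Down Up"
    have "cinner (ket (j + 1/2) (\<mu> + 1/2) (n - 1/2) Down) (fst (W (x, y)))
      = of_real (- q * ?b) * X + of_real ?a * Y"
      using cinner_ket_Down_As[OF y l] cinner_ket_Down_B[OF x l]
      by (simp add: W_eq cinner_add_right cinner_scaleR_right X_def Y_def add.assoc
          del: scaleR_minus_left)
    moreover have "- q * ?b = coeff j \<mu> n * sqrt (qnum q (j + n + 1/2))
        * (q powr (-j) * sqrt (qnum q (j + \<mu> + 1)))"
    proof -
      have "- q * ?b = (q * q powr (-j - 1)) * q powr ((\<mu> + n - 1/2) / 2)
          * sqrt (qnum q (j + \<mu> + 1)) * sqrt (qnum q (j + n + 1/2)) / ?N"
        by (simp add: beta_plus_def algebra_simps)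
      then show ?thesis unfolding qq by (simp add: coeff_def)
    qed
    moreover have "?a = - (coeff j \<mu> n * sqrt (qnum q (j + n + 1/2))
        * (q powr (1/2) * sqrt (qnum q (j - \<mu>))))"
      by (simp add: alpha_minus_def coeff_def algebra_simps)
    ultimately show "cinner (ket (j + 1/2) (\<mu> + 1/2) (n - 1/2) Down) (fst (W (x, y)))
      = of_real (coeff j \<mu> n * sqrt (qnum q (j + n + 1/2))) * form_W j \<mu> X Y"
      unfolding form_W_def by (rule real_lincomb_factor)
  }
  {
    assume l: "is_label (j + 1/2) (\<mu> + 1/2) (n + 1/2) Down"
    let ?a = "mat2_entry (alpha_plus q j \<mu> n) Down Up"
    let ?b = "mat2_entry (beta_minus q (j + 1/2) (\<mu> + 1/2) (n + 1/2)) Up Down"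
    have "cinner (ket (j + 1/2) (\<mu> + 1/2) (n + 1/2) Down) (snd (W (x, y)))
      = of_real ?a * X + of_real ?b * Y"
      using cinner_ket_Down_A[OF x l] cinner_ket_Down_Bs[OF y l]
      by (simp add: W_eq cinner_add_right X_def Y_def add.assoc)
    moreover have "?a = coeff j \<mu> n * sqrt (qnum q (j - n + 1/2)) * q powr (j + 1/2)
        * (q powr (-j) * sqrt (qnum q (j + \<mu> + 1)))"
    proof -
      have "?a = q powr (1/2) * q powr ((\<mu> + n - 1/2) / 2)
          * sqrt (qnum q (j + \<mu> + 1)) * sqrt (qnum q (j - n + 1/2)) / ?N"
        by (simp add: alpha_plus_def)
      then show ?thesis unfolding qj[symmetric] by (simp add: coeff_def)
    qed
    moreover have "?b = - (coeff j \<mu> n * sqrt (qnum q (j - n + 1/2)) * q powr (j + 1/2)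
        * (q powr (1/2) * sqrt (qnum q (j - \<mu>))))"
    proof -
      have "?b = - (q powr ((\<mu> + n + 1/2) / 2) * q powr (j + 1/2)
          * sqrt (qnum q (j - \<mu>)) * sqrt (qnum q (j - n + 1/2)) / ?N)"
        by (simp add: beta_minus_def algebra_simps)
      then show ?thesis unfolding shift by (simp add: coeff_def)
    qed
    ultimately show "cinner (ket (j + 1/2) (\<mu> + 1/2) (n + 1/2) Down) (snd (W (x, y)))
      = of_real (coeff j \<mu> n * sqrt (qnum q (j - n + 1/2)) * q powr (j + 1/2)) * form_W j \<mu> X Y"
      unfolding form_W_def by (rule real_lincomb_factor)
  }
qed

section \<open>Norms of the blocks\<close>

text \<open>Both are \<open>qnum_add\<close> times a power of q, for the splittings of 2j+2 into
  (j+\<mu>+1) + (j-\<mu>+1) and into (j+n+3/2) + (j-n+1/2). They evaluate the two sums of squares in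
  the block norm of \<open>V\<close>.\<close>

lemma qnum_sum_V:
  fixes j \<mu> n :: real
  shows "qnum q (j - \<mu> + 1) * q powr (2*j + 2) + qnum q (j + \<mu> + 1)
      = q powr (j + 1 - \<mu>) * qnum q (2*j + 2)"
    and "q * qnum q (j - n + 1/2) + q powr (-2*j - 1) * qnum q (j + n + 3/2)
      = q powr (-j - n - 1/2) * qnum q (2*j + 2)"
proof -
  have "qnum q (2*j + 2) = q powr (-j + \<mu> - 1) * qnum q (j + \<mu> + 1) + q powr (j + \<mu> + 1) * qnum q (j - \<mu> + 1)"
    using qnum_add[OF q(1), of "j + \<mu> + 1" "j - \<mu> + 1"] by (simp add: algebra_simps)
  moreover have "q powr (j + 1 - \<mu>) * q powr (-j + \<mu> - 1) = q powr 0"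
    "q powr (j + 1 - \<mu>) * q powr (j + \<mu> + 1) = q powr (2*j + 2)"
    by (rule powr_mult_eq, simp)+
  ultimately show "qnum q (j - \<mu> + 1) * q powr (2*j + 2) + qnum q (j + \<mu> + 1)
      = q powr (j + 1 - \<mu>) * qnum q (2*j + 2)"
    using q by (simp add: ring_distribs flip: mult.assoc)
  have "qnum q (2*j + 2) = q powr (-j + n - 1/2) * qnum q (j + n + 3/2) + q powr (j + n + 3/2) * qnum q (j - n + 1/2)"
    using qnum_add[OF q(1), of "j + n + 3/2" "j - n + 1/2"] by (simp add: algebra_simps)
  moreover have "q powr (-j - n - 1/2) * q powr (-j + n - 1/2) = q powr (-2*j - 1)"
    "q powr (-j - n - 1/2) * q powr (j + n + 3/2) = q powr 1"
    by (rule powr_mult_eq, simp)+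
  ultimately show "q * qnum q (j - n + 1/2) + q powr (-2*j - 1) * qnum q (j + n + 3/2)
      = q powr (-j - n - 1/2) * qnum q (2*j + 2)"
    using q by (simp add: ring_distribs flip: mult.assoc)
qed

text \<open>Here 2j+1 is split, as (j+n+1/2) + (j-n+1/2) and as (j+\<mu>+1) + (j-\<mu>). Hence the
  blocks of \<open>W\<close> cancel the factor [2j+1] of \<open>coeff\<close> and keep
  [2j+2].\<close>

lemma qnum_sum_W:
  fixes j \<mu> n :: real
  shows "qnum q (j + n + 1/2) + qnum q (j - n + 1/2) * q powr (2*j + 1)
      = q powr (j + 1/2 - n) * qnum q (2*j + 1)"
    and "q powr (-2*j) * qnum q (j + \<mu> + 1) + q * qnum q (j - \<mu>)
      = q powr (-j - \<mu>) * qnum q (2*j + 1)"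
proof -
  have "qnum q (2*j + 1) = q powr (-j + n - 1/2) * qnum q (j + n + 1/2) + q powr (j + n + 1/2) * qnum q (j - n + 1/2)"
    using qnum_add[OF q(1), of "j + n + 1/2" "j - n + 1/2"] by (simp add: algebra_simps)
  moreover have "q powr (j + 1/2 - n) * q powr (-j + n - 1/2) = q powr 0"
    "q powr (j + 1/2 - n) * q powr (j + n + 1/2) = q powr (2*j + 1)"
    by (rule powr_mult_eq, simp)+
  ultimately show "qnum q (j + n + 1/2) + qnum q (j - n + 1/2) * q powr (2*j + 1)
      = q powr (j + 1/2 - n) * qnum q (2*j + 1)"
    using q by (simp add: ring_distribs flip: mult.assoc)
  have "qnum q (2*j + 1) = q powr (\<mu> - j) * qnum q (j + \<mu> + 1) + q powr (j + \<mu> + 1) * qnum q (j - \<mu>)"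
    using qnum_add[OF q(1), of "j + \<mu> + 1" "j - \<mu>"] by (simp add: algebra_simps)
  moreover have "q powr (-j - \<mu>) * q powr (\<mu> - j) = q powr (-2*j)"
    "q powr (-j - \<mu>) * q powr (j + \<mu> + 1) = q powr 1"
    by (rule powr_mult_eq, simp)+
  ultimately show "q powr (-2*j) * qnum q (j + \<mu> + 1) + q * qnum q (j - \<mu>)
      = q powr (-j - \<mu>) * qnum q (2*j + 1)"
    using q by (simp add: ring_distribs flip: mult.assoc)
qed

text \<open>The two sums of squares produce [2j+2]^2 and powers of q that cancel the one in
  \<open>coeff\<close>. The assumptions keep all radicands nonnegative; the lower bound on n admits
  blocks where only n + 1 belongs to a label.\<close>

lemma norm_block_V:
  assumes "0 \<le> j" "-j \<le> \<mu>" "\<mu> \<le> j" "-j - 3/2 \<le> n" "n \<le> j + 1/2"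
  shows "((coeff j \<mu> n * sqrt (qnum q (j - \<mu> + 1)) * q powr (j + 1))\<^sup>2
      + (coeff j \<mu> n * sqrt (qnum q (j + \<mu> + 1)))\<^sup>2)
    * ((q powr (1/2) * sqrt (qnum q (j - n + 1/2)))\<^sup>2
      + (q powr (-j - 1/2) * sqrt (qnum q (j + n + 3/2)))\<^sup>2)
    = 1 / (qnum q (2*j + 1))\<^sup>2"
proof -
  have pos: "qnum q (2*j + 1) > 0" "qnum q (2*j + 2) > 0"
    using qnum_ge_one[OF q, of "2*j + 1"] qnum_ge_one[OF q, of "2*j + 2"] assms by auto
  have e: "(coeff j \<mu> n * sqrt (qnum q (j - \<mu> + 1)) * q powr (j + 1))\<^sup>2
      + (coeff j \<mu> n * sqrt (qnum q (j + \<mu> + 1)))\<^sup>2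
    = (coeff j \<mu> n)\<^sup>2 * (q powr (j + 1 - \<mu>) * qnum q (2*j + 2))"
    unfolding qnum_sum_V(1)[symmetric] using assms
    by (simp add: power_mult_distrib sqrt_qnum_sq powr_square algebra_simps)
  have a: "(q powr (1/2) * sqrt (qnum q (j - n + 1/2)))\<^sup>2
      + (q powr (-j - 1/2) * sqrt (qnum q (j + n + 3/2)))\<^sup>2
    = q powr (-j - n - 1/2) * qnum q (2*j + 2)"
    unfolding qnum_sum_V(2)[symmetric] using assms q
    by (simp add: power_mult_distrib sqrt_qnum_sq powr_square algebra_simps)
  have "q powr (\<mu> + n - 1/2) * q powr (j + 1 - \<mu>) * q powr (-j - n - 1/2) = 1"
    using q by (simp flip: powr_add)
  then have "(q powr (\<mu> + n - 1/2) * (q powr (j + 1 - \<mu>) * qnum q (2*j + 2)))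
      * (q powr (-j - n - 1/2) * qnum q (2*j + 2)) = (qnum q (2*j + 2))\<^sup>2"
    by (simp add: power2_eq_square algebra_simps)
  then show ?thesis
    unfolding e a coeff_sq using pos by (simp add: field_simps)
qed

lemma norm_block_W:
  assumes "0 \<le> j" "-j - 1 \<le> \<mu>" "\<mu> \<le> j" "-j - 1/2 \<le> n" "n \<le> j + 1/2"
  shows "((coeff j \<mu> n * sqrt (qnum q (j + n + 1/2)))\<^sup>2
      + (coeff j \<mu> n * sqrt (qnum q (j - n + 1/2)) * q powr (j + 1/2))\<^sup>2)
    * ((q powr (-j) * sqrt (qnum q (j + \<mu> + 1)))\<^sup>2 + (q powr (1/2) * sqrt (qnum q (j - \<mu>)))\<^sup>2)
    = 1 / (qnum q (2*j + 2))\<^sup>2"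
proof -
  have pos: "qnum q (2*j + 1) > 0" "qnum q (2*j + 2) > 0"
    using qnum_ge_one[OF q, of "2*j + 1"] qnum_ge_one[OF q, of "2*j + 2"] assms by auto
  have e: "(coeff j \<mu> n * sqrt (qnum q (j + n + 1/2)))\<^sup>2
      + (coeff j \<mu> n * sqrt (qnum q (j - n + 1/2)) * q powr (j + 1/2))\<^sup>2
    = (coeff j \<mu> n)\<^sup>2 * (q powr (j + 1/2 - n) * qnum q (2*j + 1))"
    unfolding qnum_sum_W(1)[symmetric] using assms
    by (simp add: power_mult_distrib sqrt_qnum_sq powr_square algebra_simps)
  have a: "(q powr (-j) * sqrt (qnum q (j + \<mu> + 1)))\<^sup>2 + (q powr (1/2) * sqrt (qnum q (j - \<mu>)))\<^sup>2
    = q powr (-j - \<mu>) * qnum q (2*j + 1)"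
    unfolding qnum_sum_W(2)[symmetric] using assms q
    by (simp add: power_mult_distrib sqrt_qnum_sq powr_square algebra_simps)
  have "q powr (\<mu> + n - 1/2) * q powr (j + 1/2 - n) * q powr (-j - \<mu>) = 1"
    using q by (simp flip: powr_add)
  then have "(q powr (\<mu> + n - 1/2) * (q powr (j + 1/2 - n) * qnum q (2*j + 1)))
      * (q powr (-j - \<mu>) * qnum q (2*j + 1)) = (qnum q (2*j + 1))\<^sup>2"
    by (simp add: power2_eq_square algebra_simps)
  then show ?thesis
    unfolding e a coeff_sq using pos by (simp add: field_simps)
qed

text \<open>Only some of the four labels of a block need exist. A missing one can only decrease the
  left-hand side, because \<open>ket\<close> is \<open>0\<close> there.\<close>

lemma block_V_bound:
  fixes j \<mu> n :: real
  assumes x: "up_part x = x" and y: "up_part y = y"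
  defines "X \<equiv> cinner (ket j \<mu> n Up) x" and "Y \<equiv> cinner (ket j \<mu> (n + 1) Up) y"
    and "g1 \<equiv> (cmod (cinner (ket (j + 1/2) (\<mu> - 1/2) (n + 1/2) Down) (fst (V (x, y)))))\<^sup>2"
    and "g2 \<equiv> (cmod (cinner (ket (j + 1/2) (\<mu> + 1/2) (n + 1/2) Down) (snd (V (x, y)))))\<^sup>2"
  assumes l: "is_label j \<mu> n Up \<or> is_label j \<mu> (n + 1) Up"
  shows "g1 + g2 \<le> 1 / (qnum q (2*j + 1))\<^sup>2 * ((cmod X)\<^sup>2 + (cmod Y)\<^sup>2)"
proof (rule rank_one_block_bound[OF _ _ form_V_def norm_block_V])
  show "0 \<le> j" "-j \<le> \<mu>" "\<mu> \<le> j" "-j - 3/2 \<le> n" "n \<le> j + 1/2"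
    using l is_label_bounds[of j \<mu> n Up] is_label_bounds[of j \<mu> "n + 1" Up] by auto
  show "g1 \<le> (coeff j \<mu> n * sqrt (qnum q (j - \<mu> + 1)) * q powr (j + 1) * cmod (form_V j n X Y))\<^sup>2"
  proof (cases "is_label (j + 1/2) (\<mu> - 1/2) (n + 1/2) Down")
    case True
    show ?thesis using down_V(1)[OF x y True]
      by (simp add: g1_def X_def Y_def norm_mult power_mult_distrib)
  qed (simp add: g1_def ket_def)
  show "g2 \<le> (coeff j \<mu> n * sqrt (qnum q (j + \<mu> + 1)) * cmod (form_V j n X Y))\<^sup>2"
  proof (cases "is_label (j + 1/2) (\<mu> + 1/2) (n + 1/2) Down")
    case True
    show ?thesis using down_V(2)[OF x y True]
      by (simp add: g2_def X_def Y_def norm_mult power_mult_distrib)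
  qed (simp add: g2_def ket_def)
qed

lemma block_W_bound:
  fixes j \<mu> n :: real
  assumes x: "up_part x = x" and y: "up_part y = y"
  defines "X \<equiv> cinner (ket j \<mu> n Up) x" and "Y \<equiv> cinner (ket j (\<mu> + 1) n Up) y"
    and "g1 \<equiv> (cmod (cinner (ket (j + 1/2) (\<mu> + 1/2) (n - 1/2) Down) (fst (W (x, y)))))\<^sup>2"
    and "g2 \<equiv> (cmod (cinner (ket (j + 1/2) (\<mu> + 1/2) (n + 1/2) Down) (snd (W (x, y)))))\<^sup>2"
  assumes l: "is_label j \<mu> n Up \<or> is_label j (\<mu> + 1) n Up"
  shows "g1 + g2 \<le> 1 / (qnum q (2*j + 2))\<^sup>2 * ((cmod X)\<^sup>2 + (cmod Y)\<^sup>2)"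
proof (rule rank_one_block_bound[OF _ _ form_W_def norm_block_W])
  show "0 \<le> j" "-j - 1 \<le> \<mu>" "\<mu> \<le> j" "-j - 1/2 \<le> n" "n \<le> j + 1/2"
    using l is_label_bounds[of j \<mu> n Up] is_label_bounds[of j "\<mu> + 1" n Up] by auto
  show "g1 \<le> (coeff j \<mu> n * sqrt (qnum q (j + n + 1/2)) * cmod (form_W j \<mu> X Y))\<^sup>2"
  proof (cases "is_label (j + 1/2) (\<mu> + 1/2) (n - 1/2) Down")
    case True
    show ?thesis using down_W(1)[OF x y True]
      by (simp add: g1_def X_def Y_def norm_mult power_mult_distrib)
  qed (simp add: g1_def ket_def)
  show "g2 \<le> (coeff j \<mu> n * sqrt (qnum q (j - n + 1/2)) * q powr (j + 1/2) * cmod (form_W j \<mu> X Y))\<^sup>2"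
  proof (cases "is_label (j + 1/2) (\<mu> + 1/2) (n + 1/2) Down")
    case True
    show ?thesis using down_W(2)[OF x y True]
      by (simp add: g2_def X_def Y_def norm_mult power_mult_distrib)
  qed (simp add: g2_def ket_def)
qed

section \<open>The exceptional block\<close>

text \<open>For j = 0 and n = -1/2 the form \<open>form_V\<close> is a multiple of q X - Y; this is
  the unit vector representing it. It plays the part of u in the index criterion.\<close>

definition xi :: "hspace \<times> hspace" where
  "xi = (1 / sqrt (1 + q\<^sup>2)) *\<^sub>R (q *\<^sub>R ket 0 0 (-(1/2)) Up, (-1) *\<^sub>R ket 0 0 (1/2) Up)"

lemma cinner_xi:
  "cinner xi (x, y) = (of_real q * cinner (ket 0 0 (-(1/2)) Up) x - cinner (ket 0 0 (1/2) Up) y)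
    / of_real (sqrt (1 + q\<^sup>2))"
  unfolding xi_def cinner_scaleR_left
  by (simp add: cinner_prod_def cinner_scaleR_left divide_simps del: scaleR_minus1_left scaleR_minus_left)

lemma norm_xi: "norm xi = 1"
proof -
  have "cinner xi xi = (of_real (q\<^sup>2 + 1) / of_real (sqrt (1 + q\<^sup>2))) / of_real (sqrt (1 + q\<^sup>2))"
    unfolding xi_def cinner_scaleR_right cinner_xi[unfolded xi_def]
    by (simp add: cinner_scaleR_right cinner_ket_ket power2_eq_square add_divide_distrib
        cinner_scaleR_right[of _ "-1", simplified])
  also have "\<dots> = of_real ((q\<^sup>2 + 1) / (sqrt (1 + q\<^sup>2))\<^sup>2)"
    by (simp only: of_real_divide of_real_mult power2_eq_square divide_divide_eq_left)
  also have "(q\<^sup>2 + 1) / (sqrt (1 + q\<^sup>2))\<^sup>2 = 1"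
  proof -
    have "1 + q\<^sup>2 > 0" by (simp add: add_pos_nonneg)
    then show ?thesis by (simp add: add.commute)
  qed
  finally have "(norm xi)\<^sup>2 = 1\<^sup>2" by (simp add: norm_sq_eq_cinner)
  then show ?thesis by (simp only: power2_eq_iff_nonneg norm_ge_zero zero_le_one)
qed

lemma E_proj_xi: "E_proj xi = xi"
  by (simp add: xi_def E_proj_eq bounded_clinearD[OF bounded_clinear_up_part] up_part_ket
      del: scaleR_minus1_left scaleR_minus_left)

text \<open>K has eigenvalue q on the first component and 1/q on the second; the factors 1/q and q
  of \<open>Ktilde\<close> bring both to 1. This eigenvalue is the value of the index.\<close>

lemma Ktilde_xi: "c *\<^sub>C xi \<in> Ktilde_dom q" "Ktilde q (c *\<^sub>C xi) = c *\<^sub>C xi"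
proof -
  define a where "a = c * of_real (1 / sqrt (1 + q\<^sup>2))"
  have xi: "c *\<^sub>C xi = (a *\<^sub>C q *\<^sub>R ket 0 0 (-(1/2)) Up, a *\<^sub>C (-1) *\<^sub>R ket 0 0 (1/2) Up)"
    unfolding xi_def a_def by (simp add: scaleR_eq_scaleC scaleC_prod_def scaleC_scaleC)
  show "c *\<^sub>C xi \<in> Ktilde_dom q"
    unfolding xi by (simp add: Ktilde_dom_def diag_dom_scaleC diag_dom_scaleR diag_op_K_ket
        del: scaleR_minus1_left scaleR_minus_left)
  have "inverse q *\<^sub>R a *\<^sub>C q *\<^sub>R q *\<^sub>R x = a *\<^sub>C q *\<^sub>R x" "q *\<^sub>R a *\<^sub>C (-1) *\<^sub>R inverse q *\<^sub>R x = a *\<^sub>C (-1) *\<^sub>R x"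
    for x :: hspace
  proof -
    have e: "inverse (of_real q) * (a * (of_real q * of_real q)) = a * of_real q"
      "of_real q * (a * inverse (of_real q)) = a"
      using q by (simp_all add: field_simps)
    show "inverse q *\<^sub>R a *\<^sub>C q *\<^sub>R q *\<^sub>R x = a *\<^sub>C q *\<^sub>R x"
      "q *\<^sub>R a *\<^sub>C (-1) *\<^sub>R inverse q *\<^sub>R x = a *\<^sub>C (-1) *\<^sub>R x"
      by (simp_all add: scaleR_eq_scaleC scaleC_scaleC e del: scaleR_minus1_left scaleR_minus_left)
  qed
  then show "Ktilde q (c *\<^sub>C xi) = c *\<^sub>C xi"
    unfolding xi Ktilde_def using q
    by (simp add: diag_dom_scaleC diag_dom_scaleR diag_op_scaleC diag_op_scaleR
        diag_op_K_ket powr_minus del: scaleR_minus1_left scaleR_minus_left)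
qed

text \<open>Since [1] = 1 and [2] = q + 1/q, the two target coefficients combine to the weight 1 /
  (1 + q^2) on the squared modulus of q X - Y, which is the normalization of
  \<open>xi\<close>.\<close>

lemma lowest_block_V:
  assumes x: "up_part x = x" and y: "up_part y = y"
  shows "(cmod (cinner (ket (1/2) (-(1/2)) 0 Down) (fst (V (x, y)))))\<^sup>2
      + (cmod (cinner (ket (1/2) (1/2) 0 Down) (snd (V (x, y)))))\<^sup>2
      = (cmod (cinner xi (x, y)))\<^sup>2"
proof -
  define X where "X = cinner (ket 0 0 (-(1/2)) Up) x"
  define Y where "Y = cinner (ket 0 0 (1/2) Up) y"
  let ?e = "coeff 0 0 (-(1/2))"
  have V: "cinner (ket (1/2) (-(1/2)) 0 Down) (fst (V (x, y))) = of_real (?e * q) * form_V 0 (-(1/2)) X Y"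
    "cinner (ket (1/2) (1/2) 0 Down) (snd (V (x, y))) = of_real ?e * form_V 0 (-(1/2)) X Y"
    using down_V[OF x y, of 0 0 "-(1/2)"] q by (simp_all add: X_def Y_def qnum_one)
  have "form_V 0 (-(1/2)) X Y = of_real (q powr (1/2)) * X - of_real (q powr (-(1/2))) * Y"
    using q by (simp add: form_V_def qnum_one)
  also have "\<dots> = of_real (q powr (-(1/2))) * (of_real q * X - Y)"
    using powr_mult_eq[of "-(1/2)" 1 "1/2" q] q by (simp add: algebra_simps flip: of_real_mult)
  finally have "(cmod (form_V 0 (-(1/2)) X Y))\<^sup>2
      = (q powr (-(1/2)))\<^sup>2 * (cmod (of_real q * X - Y))\<^sup>2"
    by (simp only: norm_mult norm_of_real power_mult_distrib power2_abs)
  moreover have "(q powr (-(1/2)))\<^sup>2 = inverse q"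
    unfolding powr_square using q by (simp add: powr_minus)
  ultimately have "(cmod (form_V 0 (-(1/2)) X Y))\<^sup>2 = (cmod (of_real q * X - Y))\<^sup>2 / q"
    by (simp only: divide_inverse mult.commute)
  moreover have "?e\<^sup>2 = q / (1 + q\<^sup>2)\<^sup>2"
  proof -
    have "q + inverse q = (1 + q\<^sup>2) / q" using q by (simp add: field_simps power2_eq_square)
    then have "?e\<^sup>2 = inverse q / ((1 + q\<^sup>2) / q)\<^sup>2"
      using q coeff_sq[of 0 0 "-(1/2)"] by (simp add: qnum_one qnum_two powr_minus)
    moreover have "inverse q / (t / q)\<^sup>2 = q / t\<^sup>2" for t
      using q by (cases "t = 0") (simp_all add: field_simps power2_eq_square)
    ultimately show ?thesis by simp
  qed
  ultimately have "(cmod (of_real (?e * q) * form_V 0 (-(1/2)) X Y))\<^sup>2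
      + (cmod (of_real ?e * form_V 0 (-(1/2)) X Y))\<^sup>2
    = (q / (1 + q\<^sup>2)\<^sup>2 * q\<^sup>2 + q / (1 + q\<^sup>2)\<^sup>2) * ((cmod (of_real q * X - Y))\<^sup>2 / q)"
    by (simp only: norm_mult norm_of_real power_mult_distrib power2_abs ring_distribs(2))
  also have "\<dots> = (cmod (of_real q * X - Y))\<^sup>2 * ((1 + q\<^sup>2) / (1 + q\<^sup>2)\<^sup>2)"
    using q by (simp add: ring_distribs add_divide_distrib)
  also have "(1 + q\<^sup>2) / (1 + q\<^sup>2)\<^sup>2 = 1 / (1 + q\<^sup>2)"
    by (simp add: power2_eq_square[of "1 + q\<^sup>2"])
  finally show ?thesis
    unfolding V by (simp add: cinner_xi X_def Y_def norm_divide power_divide)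
qed

section \<open>Uniform bounds for all blocks\<close>

lemma block_V_bound_xi:
  fixes j \<mu> n :: real
  assumes x: "up_part x = x" and y: "up_part y = y"
  defines "X \<equiv> cinner (ket j \<mu> n Up) x" and "Y \<equiv> cinner (ket j \<mu> (n + 1) Up) y"
    and "g1 \<equiv> (cmod (cinner (ket (j + 1/2) (\<mu> - 1/2) (n + 1/2) Down) (fst (V (x, y)))))\<^sup>2"
    and "g2 \<equiv> (cmod (cinner (ket (j + 1/2) (\<mu> + 1/2) (n + 1/2) Down) (snd (V (x, y)))))\<^sup>2"
  shows "g1 + g2 \<le> 1/4 * ((cmod X)\<^sup>2 + (cmod Y)\<^sup>2)
    + (if (j, \<mu>, n) = (0, 0, -(1/2)) then 3/4 * (cmod (cinner xi (x, y)))\<^sup>2 else 0)"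
proof (cases "is_label j \<mu> n Up \<or> is_label j \<mu> (n + 1) Up")
  case False
  then have XY: "X = 0" "Y = 0" by (simp_all add: X_def Y_def ket_def)
  \<comment> \<open>A target may be a label although no source is; its component is then a multiple
    of the form at zero arguments.\<close>
  have "g1 = 0" "g2 = 0"
    unfolding g1_def g2_def using down_V[OF x y, of j \<mu> n] XY
    by (auto simp: X_def Y_def form_V_def ket_def)
  then show ?thesis by (simp add: XY)
next
  case True
  have bound: "g1 + g2 \<le> 1 / (qnum q (2*j + 1))\<^sup>2 * ((cmod X)\<^sup>2 + (cmod Y)\<^sup>2)"
    unfolding g1_def g2_def X_def Y_def by (rule block_V_bound[OF x y True])
  consider "1/2 \<le> j" | "j = 0" "n = -(1/2)" | "j = 0" "n \<noteq> -(1/2)"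
    using True label_half_or_zero by blast
  then show ?thesis
  proof cases
    case 1
    then have "2 \<le> qnum q (2*j + 1)" by (intro qnum_ge_two q) simp
    then have "2\<^sup>2 \<le> (qnum q (2*j + 1))\<^sup>2" by (intro power_mono) auto
    then have "1 / (qnum q (2*j + 1))\<^sup>2 \<le> 1/4" by (simp add: divide_simps)
    then have "1 / (qnum q (2*j + 1))\<^sup>2 * ((cmod X)\<^sup>2 + (cmod Y)\<^sup>2) \<le> 1/4 * ((cmod X)\<^sup>2 + (cmod Y)\<^sup>2)"
      by (rule mult_right_mono) simp
    with bound have "g1 + g2 \<le> 1/4 * ((cmod X)\<^sup>2 + (cmod Y)\<^sup>2)" by (rule order_trans)
    with 1 show ?thesis by auto
  next
    case 2
    then have "\<mu> = 0" using True is_label_bounds(2,3)[of j \<mu> _ Up] by fastforce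
    with 2 have "g1 + g2 = (cmod (cinner xi (x, y)))\<^sup>2"
      using lowest_block_V[OF x y] by (simp add: g1_def g2_def)
    moreover have "g1 + g2 \<le> (cmod X)\<^sup>2 + (cmod Y)\<^sup>2"
      using bound 2 q by (simp add: qnum_one)
    \<comment> \<open>A convex combination, with weights 1/4 and 3/4, of the two preceding estimates
      of g1 + g2.\<close>
    ultimately have "g1 + g2 \<le> 1/4 * ((cmod X)\<^sup>2 + (cmod Y)\<^sup>2) + 3/4 * (cmod (cinner xi (x, y)))\<^sup>2"
      by argo
    then show ?thesis using 2 \<open>\<mu> = 0\<close> by simp
  next
    case 3
    \<comment> \<open>Targets lie at 1/2, where a down label forces n + 1/2 = 0.\<close>
    then have "\<not> is_label (j + 1/2) m (n + 1/2) Down" for m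
      using Down_label_half[of m "n + 1/2"] by auto
    then have "g1 = 0" "g2 = 0" by (simp_all add: g1_def g2_def ket_def)
    then show ?thesis by simp
  qed
qed

text \<open>As 2j+2 is at least 2 for every label, no block of \<open>W\<close> is
  exceptional.\<close>

lemma block_W_bound_quarter:
  fixes j \<mu> n :: real
  assumes x: "up_part x = x" and y: "up_part y = y"
  defines "X \<equiv> cinner (ket j \<mu> n Up) x" and "Y \<equiv> cinner (ket j (\<mu> + 1) n Up) y"
    and "g1 \<equiv> (cmod (cinner (ket (j + 1/2) (\<mu> + 1/2) (n - 1/2) Down) (fst (W (x, y)))))\<^sup>2"
    and "g2 \<equiv> (cmod (cinner (ket (j + 1/2) (\<mu> + 1/2) (n + 1/2) Down) (snd (W (x, y)))))\<^sup>2"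
  shows "g1 + g2 \<le> 1/4 * ((cmod X)\<^sup>2 + (cmod Y)\<^sup>2)"
proof (cases "is_label j \<mu> n Up \<or> is_label j (\<mu> + 1) n Up")
  case False
  then have XY: "X = 0" "Y = 0" by (simp_all add: X_def Y_def ket_def)
  have "g1 = 0" "g2 = 0"
    unfolding g1_def g2_def using down_W[OF x y, of j \<mu> n] XY
    by (auto simp: X_def Y_def form_W_def ket_def)
  then show ?thesis by (simp add: XY)
next
  case True
  have "0 \<le> j" using True is_label_bounds(1) by blast
  then have "2 \<le> qnum q (2*j + 2)" by (intro qnum_ge_two q) simp
  then have "2\<^sup>2 \<le> (qnum q (2*j + 2))\<^sup>2" by (intro power_mono) auto
  then have "1 / (qnum q (2*j + 2))\<^sup>2 \<le> 1/4" by (simp add: divide_simps)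
  then have "1 / (qnum q (2*j + 2))\<^sup>2 * ((cmod X)\<^sup>2 + (cmod Y)\<^sup>2) \<le> 1/4 * ((cmod X)\<^sup>2 + (cmod Y)\<^sup>2)"
    by (rule mult_right_mono) simp
  moreover have "g1 + g2 \<le> 1 / (qnum q (2*j + 2))\<^sup>2 * ((cmod X)\<^sup>2 + (cmod Y)\<^sup>2)"
    unfolding g1_def g2_def X_def Y_def by (rule block_W_bound[OF x y True])
  ultimately show ?thesis by linarith
qed

section \<open>Summation over the blocks, and the index\<close>

lemma E_proj_fixed: "E_proj (x, y) = (x, y) \<longleftrightarrow> up_part x = x \<and> up_part y = y"
  by (simp add: E_proj_eq)

text \<open>Parseval for the down parts of both components, each reindexed so that the two targets
  of one block stand at the triple of its source.\<close>

lemma off_diagonal_V_sums: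
  "((\<lambda>(j, \<mu>, n). (cmod (cinner (ket (j + 1/2) (\<mu> - 1/2) (n + 1/2) Down) (fst (V z))))\<^sup>2
      + (cmod (cinner (ket (j + 1/2) (\<mu> + 1/2) (n + 1/2) Down) (snd (V z))))\<^sup>2)
    has_sum (norm (V z - E_proj (V z)))\<^sup>2) UNIV"
  using has_sum_add[OF has_sum_ket_down[of "1/2" "-(1/2)" "1/2" "fst (V z)"]
      has_sum_ket_down[of "1/2" "1/2" "1/2" "snd (V z)"]]
  by (simp add: norm_E_proj_compl case_prod_beta')

lemma off_diagonal_W_sums:
  "((\<lambda>(j, \<mu>, n). (cmod (cinner (ket (j + 1/2) (\<mu> + 1/2) (n - 1/2) Down) (fst (W z))))\<^sup>2
      + (cmod (cinner (ket (j + 1/2) (\<mu> + 1/2) (n + 1/2) Down) (snd (W z))))\<^sup>2)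
    has_sum (norm (W z - E_proj (W z)))\<^sup>2) UNIV"
  using has_sum_add[OF has_sum_ket_down[of "1/2" "1/2" "-(1/2)" "fst (W z)"]
      has_sum_ket_down[of "1/2" "1/2" "1/2" "snd (W z)"]]
  by (simp add: norm_E_proj_compl case_prod_beta')

text \<open>The offsets b, c pair the two sources of a block: 0, 1 for \<open>V\<close> and 1, 0 for
  \<open>W\<close>.\<close>

lemma quarter_norm_sums:
  assumes "E_proj z = z"
  shows "((\<lambda>(j, \<mu>, n). 1/4 * ((cmod (cinner (ket j \<mu> n Up) (fst z)))\<^sup>2
      + (cmod (cinner (ket j (\<mu> + b) (n + c) Up) (snd z)))\<^sup>2)) has_sum (norm z)\<^sup>2 / 4) UNIV"
proof -
  obtain x y where z: "z = (x, y)" and x: "up_part x = x" and y: "up_part y = y"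
    using assms by (cases z) (auto simp: E_proj_fixed)
  show ?thesis
    using has_sum_cmult_right[OF has_sum_add[OF has_sum_ket_up[OF x, of 0 0 0]
          has_sum_ket_up[OF y, of 0 b c]], of "1/4"]
    by (simp add: z norm_prod_def case_prod_beta')
qed

lemma off_diagonal_V_le:
  assumes "E_proj z = z"
  shows "(norm (V z - E_proj (V z)))\<^sup>2 \<le> (norm z)\<^sup>2 / 4 + 3/4 * (cmod (cinner xi z))\<^sup>2"
proof (rule has_sum_mono[OF off_diagonal_V_sums])
  obtain x y where z: "z = (x, y)" and x: "up_part x = x" and y: "up_part y = y"
    using assms by (cases z) (auto simp: E_proj_fixed)
  \<comment> \<open>The correction is concentrated at the single triple of the exceptional block, so
    it sums to its one value.\<close>
  let ?s = "\<lambda>t. if t = (0, 0, -(1/2)) then 3/4 * (cmod (cinner xi z))\<^sup>2 else 0"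
  have "(?s has_sum 3/4 * (cmod (cinner xi z))\<^sup>2) UNIV"
    by (rule has_sum_finite_neutralI[of "{(0, 0, -(1/2))}"]) auto
  from has_sum_add[OF quarter_norm_sums[OF assms, of 0 1] this]
  show "((\<lambda>t. (case t of (j, \<mu>, n) \<Rightarrow> 1/4 * ((cmod (cinner (ket j \<mu> n Up) (fst z)))\<^sup>2
      + (cmod (cinner (ket j (\<mu> + 0) (n + 1) Up) (snd z)))\<^sup>2)) + ?s t)
      has_sum (norm z)\<^sup>2 / 4 + 3/4 * (cmod (cinner xi z))\<^sup>2) UNIV" .
  show "(case t of (j, \<mu>, n) \<Rightarrow> (cmod (cinner (ket (j + 1/2) (\<mu> - 1/2) (n + 1/2) Down) (fst (V z))))\<^sup>2
      + (cmod (cinner (ket (j + 1/2) (\<mu> + 1/2) (n + 1/2) Down) (snd (V z))))\<^sup>2)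
    \<le> (case t of (j, \<mu>, n) \<Rightarrow> 1/4 * ((cmod (cinner (ket j \<mu> n Up) (fst z)))\<^sup>2
      + (cmod (cinner (ket j (\<mu> + 0) (n + 1) Up) (snd z)))\<^sup>2)) + ?s t" for t
    by (cases t) (simp only: prod.case z fst_conv snd_conv add_0_right block_V_bound_xi[OF x y])
qed

lemma off_diagonal_V_xi: "1 \<le> norm (V xi - E_proj (V xi))"
proof -
  obtain x y where xi: "xi = (x, y)" and x: "up_part x = x" and y: "up_part y = y"
    using E_proj_xi by (cases xi) (auto simp: E_proj_fixed)
  have "cmod (cinner xi xi) = 1" by (simp add: cinner_self norm_xi)
  then have "1 = (cmod (cinner (ket (1/2) (-(1/2)) 0 Down) (fst (V xi))))\<^sup>2
      + (cmod (cinner (ket (1/2) (1/2) 0 Down) (snd (V xi))))\<^sup>2"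
    using lowest_block_V[OF x y, folded xi] by simp
  \<comment> \<open>The exceptional block is one term of the nonnegative sum for the off-diagonal
    part.\<close>
  also have "\<dots> \<le> (norm (V xi - E_proj (V xi)))\<^sup>2"
    using finite_sum_le_has_sum[OF off_diagonal_V_sums[of xi], of "{(0, 0, -(1/2))}"] by auto
  finally have "1\<^sup>2 \<le> (norm (V xi - E_proj (V xi)))\<^sup>2" by simp
  then show ?thesis by (rule power2_le_imp_le) simp
qed

lemma off_diagonal_W_le:
  assumes "E_proj z = z"
  shows "(norm (W z - E_proj (W z)))\<^sup>2 \<le> (norm z)\<^sup>2 / 4"
proof (rule has_sum_mono[OF off_diagonal_W_sums quarter_norm_sums[OF assms, of 1 0]])
  obtain x y where z: "z = (x, y)" and x: "up_part x = x" and y: "up_part y = y"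
    using assms by (cases z) (auto simp: E_proj_fixed)
  show "(case t of (j, \<mu>, n) \<Rightarrow> (cmod (cinner (ket (j + 1/2) (\<mu> + 1/2) (n - 1/2) Down) (fst (W z))))\<^sup>2
      + (cmod (cinner (ket (j + 1/2) (\<mu> + 1/2) (n + 1/2) Down) (snd (W z))))\<^sup>2)
    \<le> (case t of (j, \<mu>, n) \<Rightarrow> 1/4 * ((cmod (cinner (ket j \<mu> n Up) (fst z)))\<^sup>2
      + (cmod (cinner (ket j (\<mu> + 1) (n + 0) Up) (snd z)))\<^sup>2))" for t
    using block_W_bound_quarter[OF x y, of "fst t" "fst (snd t)" "snd (snd t)"]
    by (simp add: z case_prod_beta')
qed

lemma modular_index_V: "has_modular_index (Ktilde_dom q) (Ktilde q) E_proj V 1"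
  by (rule orthogonal_projection.has_modular_index_one[OF orthogonal_projection_E bounded_V V_adj
      bounded_W W_V V_W V_commutes_Ktilde norm_xi E_proj_xi Ktilde_xi off_diagonal_V_le
      off_diagonal_V_xi off_diagonal_W_le])

end

theorem proposition8:
  fixes q :: real and pi' :: "suq2_elem \<Rightarrow> hspace \<Rightarrow> hspace"
  assumes "0 < q" and "q < 1"
    and "is_pi' q pi'"
  shows "has_modular_index (Ktilde_dom q) (Ktilde q) E_proj (mat2_op pi' (V_mat q)) 1"
proof -
  interpret suq2_pi' q pi' by unfold_locales (rule assms)+
  show ?thesis using modular_index_V by (simp add: V_def)
qed

end
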